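(* For each positive integer $m$, let $G_m$ be the additive group of the finite field $\mathbb{F}_{2^m}$ and let $$D_m=\{z\in \mathbb{F}_{2^m} : z\neq 0 \text{ and } {\rm Tr}(z)={\rm Tr}(z^{-1})=1\}.$$ Then the graphs $\mathfrak{C}(G_m,D_m)$ form an infinite family of Ramanujan graphs, in the sense that $\mathfrak{C}(G_m,D_m)$ is a Ramanujan graph for infinitely many $m$.
   Context: ${\rm Tr}:\mathbb{F}_{2^m}\to\mathbb{F}_2$ is the trace map. The Cayley graph $\mathfrak{C}(G_m,D_m)$ has vertex set $\mathbb{F}_{2^m}$, and two vertices $u,v$ are adjacent if and only if $u-v\in D_m$. The eigenvalues of a graph are the eigenvalues of its adjacency matrix. A connected $k$-regular graph is called a Ramanujan graph if $\lambda\leq 2\sqrt{k-1}$ for all eigenvalues $\lambda$ of the graph with $|\lambda|\neq k$ (the first inequality is on $\lambda$ itself, as in the paper's definition). *)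

theory Defs
  imports
    "HOL-Algebra.Algebra"
    "Graph_Theory.Graph_Theory"
    "Jordan_Normal_Form.Char_Poly"
begin

(* For a field R with 2^m elements, this is the trace map R \<rightarrow> F_2, the sum of the Galois
   conjugates z^(2^i) of z; F_2 is the prime subfield {\<zero>\<^bsub>R\<^esub>, \<one>\<^bsub>R\<^esub>} of R. *)
definition field_trace :: "('a, 'b) ring_scheme \<Rightarrow> nat \<Rightarrow> 'a \<Rightarrow> 'a" where
  "field_trace R m z = (\<Oplus>\<^bsub>R\<^esub>i\<in>{..<m}. z [^]\<^bsub>R\<^esub> ((2::nat) ^ i))"

definition trace_set :: "('a, 'b) ring_scheme \<Rightarrow> nat \<Rightarrow> 'a set" where
  "trace_set R m = {z \<in> carrier R. z \<noteq> \<zero>\<^bsub>R\<^esub> \<and>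
     field_trace R m z = \<one>\<^bsub>R\<^esub> \<and> field_trace R m (inv\<^bsub>R\<^esub> z) = \<one>\<^bsub>R\<^esub>}"

(* For G = add_monoid R, the condition on (u, v) reads u - v \<in> D. *)
definition cayley_graph :: "('a, 'b) monoid_scheme \<Rightarrow> 'a set \<Rightarrow> 'a pair_pre_digraph" where
  "cayley_graph G D = \<lparr> pverts = carrier G,
     parcs = {(u, v). u \<in> carrier G \<and> v \<in> carrier G \<and> u \<otimes>\<^bsub>G\<^esub> inv\<^bsub>G\<^esub> v \<in> D} \<rparr>"

(* Matrices are indexed by {0..<n}, so an enumeration of the vertices is needed. *)
definition adjacency_matrix :: "'a pair_pre_digraph \<Rightarrow> 'a list \<Rightarrow> real mat" where
  "adjacency_matrix G vs = mat (length vs) (length vs)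
     (\<lambda>(i, j). if (vs ! i, vs ! j) \<in> parcs G then 1 else 0)"

(* Different enumerations give similar matrices, hence the same eigenvalues. The matrix of an
   undirected graph is real symmetric, so its eigenvalues are all real. *)
definition graph_eigenvalue :: "'a pair_pre_digraph \<Rightarrow> real \<Rightarrow> bool" where
  "graph_eigenvalue G l \<longleftrightarrow>
     (\<exists>vs. distinct vs \<and> set vs = pverts G \<and> eigenvalue (adjacency_matrix G vs) l)"

definition regular_graph :: "'a pair_pre_digraph \<Rightarrow> nat \<Rightarrow> bool" where
  "regular_graph G k \<longleftrightarrow> (\<forall>v \<in> pverts G. out_degree (with_proj G) v = k)"

(* The locale pair_graph describes finite simple undirected graphs. The bound is on l itself,
   not on its absolute value. *)
definition ramanujan_graph :: "'a pair_pre_digraph \<Rightarrow> bool" where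
  "ramanujan_graph G \<longleftrightarrow> pair_graph G \<and> Digraph_Component.connected (with_proj G) \<and>
     (\<exists>k. regular_graph G k \<and>
       (\<forall>l. graph_eigenvalue G l \<and> \<bar>l\<bar> \<noteq> real k \<longrightarrow> l \<le> 2 * sqrt (real k - 1)))"

end

theory Submission
  imports Defs "HOL-Library.Z2" "HOL-Algebra.Algebraic_Closure_Type"
begin

text \<open>
  Let $q = 2^m$ and let $K(a)$ be the sum of $(-1)^{\mathrm{Tr}(az + 1/z)}$ over nonzero $z$. The
  degree of the graph is $(q + 1 + K(1))/4$, the eigenvalue attached to $a \neq 0, 1$ is
  $(K(a+1) - K(a))/4$, and the one attached to $1$ is minus the degree. So by Weil's bound
  $|K(a)| \leq 2\sqrt q$ the graph is Ramanujan whenever $K(1) > 0$.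

  Passing from $q$ to $q^2$ turns $K$ into $2q - K^2$; equivalently $c = -K/(2\sqrt q)$ becomes
  $2c^2 - 1$. Hence a lower bound $K \geq -C\sqrt q$ with any constant, as given by Stepanov's
  method, already forces $|c| \leq 1$. Moreover, if $c$ stayed nonnegative along $m = 2^j$, then
  $1 - c$ would at least double at each step, which is impossible since $c \neq 1$ ($K$ is odd).
\<close>

section \<open>Finite fields of characteristic two and their additive characters\<close>

text \<open>All finite fields are sets \<open>gf n\<close> inside one algebraic closure: a quadratic
  extension is then an inclusion, and one parameter \<open>a\<close> serves a whole tower within a
  single type. Stepanov's method is run only over fields of square order, where the trace is a half
  trace plus its conjugate. A one-sided bound is enough because a violation of either sign turns
  into c > 1, a very negative sum, after one doubling. The sign of K(1) matters because Weil's bound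
  leaves a tie: the eigenvalues are at most sqrt q, while a degree k near q/4 makes 2 sqrt(k - 1)
  near sqrt q as well. The comparison sqrt q \<le> 2 sqrt(k - 1) amounts to K(1) \<ge> 3. This
  follows from K(1) > 0, since 4 divides both q + 1 + K(1) and q. Connectedness is spectral too:
  once q \<ge> 16, only the trivial character attains the degree.\<close>

type_synonym F2bar = "bit alg_closure"

lemma CHAR_bit: "CHAR(bit) = 2"
proof (rule CHAR_eqI)
  show "2 dvd n" if "of_nat n = (0::bit)" for n :: nat
    using that by (induction n rule: nat_induct2) auto
qed simp

lemma CHAR_F2bar: "CHAR(F2bar) = 2"
  by (simp add: CHAR_bit)

lemma two_F2bar [simp]: "(2::F2bar) = 0"
  by (metis CHAR_F2bar of_nat_CHAR of_nat_numeral)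

lemma add_self_F2bar [simp]: "x + x = (0::F2bar)"
  by (metis mult_2 mult_zero_left two_F2bar)

lemma uminus_F2bar [simp]: "- x = (x::F2bar)"
  by (rule minus_unique) simp

text \<open>As simp rules, this and \<open>uminus_F2bar\<close> remove every sign, so terms over
  \<open>F2bar\<close> are normalised to sums.\<close>

lemma diff_F2bar [simp]: "x - y = x + (y::F2bar)"
  using uminus_F2bar[of y] by (simp only: diff_conv_add_uminus)

lemma add_self_left_F2bar [simp]: "x + (x + y) = (y::F2bar)"
  by (simp flip: add.assoc)

lemma add_eq_0_iff_F2bar: "x + y = 0 \<longleftrightarrow> x = (y::F2bar)"
  by (metis diff_F2bar eq_iff_diff_eq_0)

lemma frob_add: "(x + y :: F2bar) ^ 2 ^ k = x ^ 2 ^ k + y ^ 2 ^ k"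
  by (rule freshmans_dream') (simp_all only: CHAR_F2bar two_is_prime_nat)

lemma frob_sum: "(sum f A :: F2bar) ^ 2 ^ k = (\<Sum>i\<in>A. f i ^ 2 ^ k)"
  by (rule freshmans_dream_sum') (simp_all only: CHAR_F2bar two_is_prime_nat)

lemma frob_frob: "((x::F2bar) ^ 2 ^ i) ^ 2 ^ j = x ^ 2 ^ (i + j)"
  by (simp add: power_add power_mult)

text \<open>The fixed field of the \<open>n\<close>-fold Frobenius. For \<open>n = 0\<close> it is
  the whole closure, hence \<open>n > 0\<close> wherever elements are counted.\<close>

definition gf :: "nat \<Rightarrow> F2bar set" where
  "gf n = {x. x ^ 2 ^ n = x}"

lemma gf_0 [simp]: "0 \<in> gf n" and gf_1 [simp]: "1 \<in> gf n"
  by (simp_all add: gf_def)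

lemma gf_add [intro]: "x \<in> gf n \<Longrightarrow> y \<in> gf n \<Longrightarrow> x + y \<in> gf n"
  by (simp add: gf_def frob_add)

lemma gf_mult [intro]: "x \<in> gf n \<Longrightarrow> y \<in> gf n \<Longrightarrow> x * y \<in> gf n"
  by (simp add: gf_def power_mult_distrib)

lemma gf_inverse [intro]: "x \<in> gf n \<Longrightarrow> inverse x \<in> gf n"
  by (simp add: gf_def power_inverse)

lemma gf_power [intro]: "x \<in> gf n \<Longrightarrow> x ^ k \<in> gf n"
  by (induction k) auto

lemma gf_sum [intro]: "(\<And>i. i \<in> A \<Longrightarrow> f i \<in> gf n) \<Longrightarrow> sum f A \<in> gf n"
  by (induction A rule: infinite_finite_induct) auto

lemma gf_iter: "x \<in> gf n \<Longrightarrow> x ^ 2 ^ (n * k) = x"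
  by (induction k) (simp_all add: gf_def flip: frob_frob)

lemma gf_dvd: "m dvd n \<Longrightarrow> gf m \<subseteq> gf n"
  using gf_iter by (auto simp: gf_def[of n] elim!: dvdE)

text \<open>X^(2^n) + X has derivative 1, so it has no repeated root and, over an algebraically
  closed field, as many roots as its degree.\<close>

lemma finite_card_gf: assumes "n > 0" shows "finite (gf n) \<and> card (gf n) = 2 ^ n"
proof -
  define p :: "F2bar poly" where "p = Polynomial.monom 1 (2 ^ n) + Polynomial.monom 1 1"
  have one: "(1::nat) < 2 ^ n" using assms by (intro one_less_power) auto
  have deg: "Polynomial.degree p = 2 ^ n"
    unfolding p_def using one by (subst degree_add_eq_left) (simp_all add: Polynomial.degree_monom_eq)
  hence p0: "p \<noteq> 0" using one by auto
  have roots: "gf n = {x. poly p x = 0}"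
    by (auto simp: gf_def p_def poly_monom add_eq_0_iff_F2bar)
  have pd: "pderiv p = 1"
    using assms by (simp add: p_def pderiv_add pderiv_monom flip: one_pCons)
  obtain A where A: "size A = Polynomial.degree p" "p = Polynomial.smult (lead_coeff p) (\<Prod>x\<in>#A. [:-x, 1:])"
    using alg_closed_imp_factorization[OF p0] by blast
  have le1: "count A x \<le> 1" for x
  proof (rule ccontr)
    assume "\<not> count A x \<le> 1"
    hence "{#x, x#} \<subseteq># A" by (simp add: subseteq_mset_def)
    then obtain B where "A = {#x, x#} + B" by (auto simp: mset_subset_eq_exists_conv)
    hence "p = [:-x,1:] * ([:-x,1:] * Polynomial.smult (lead_coeff p) (\<Prod>x\<in>#B. [:-x, 1:]))" (is "p = _ * (_ * ?q)")
      by (subst A(2)) (simp add: mult_ac)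
    hence "pderiv p = pderiv ([:-x,1:] * ([:-x,1:] * ?q))" by simp
    hence "poly (pderiv p) x = poly (pderiv ([:-x,1:] * ([:-x,1:] * ?q))) x" by (rule arg_cong)
    also have "\<dots> = 0" by (simp only: pderiv_mult poly_add poly_mult) simp
    finally show False by (simp add: pd)
  qed
  have "poly p x = 0 \<longleftrightarrow> x \<in># A" for x
  proof -
    have "poly p x = 0 \<longleftrightarrow> poly (\<Prod>x\<in>#A. [:-x, 1:]) x = 0"
      by (subst A(2)) (simp add: p0)
    also have "\<dots> \<longleftrightarrow> x \<in># A"
      by (induction A) (auto simp: add_eq_0_iff_F2bar)
    finally show ?thesis .
  qed
  hence gA: "gf n = set_mset A" using roots by auto
  moreover have "A = mset_set (set_mset A)"
    using le1 by (intro multiset_eqI) (metis count_mset_set(1,3) count_greater_zero_iff finite_set_mset le_antisym less_one not_le count_eq_zero_iff)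
  ultimately have "card (gf n) = size A" by (metis size_mset_set)
  thus ?thesis using gA A(1) deg by simp
qed

lemma finite_gf [simp]: "n > 0 \<Longrightarrow> finite (gf n)" and card_gf: "n > 0 \<Longrightarrow> card (gf n) = 2 ^ n"
  using finite_card_gf by auto

section \<open>Traces, additive characters and complete character sums\<close>

definition tr :: "nat \<Rightarrow> F2bar \<Rightarrow> F2bar" where
  "tr n x = (\<Sum>i<n. x ^ 2 ^ i)"

lemma tr_add: "tr n (x + y) = tr n x + tr n y"
  by (simp add: tr_def frob_add sum.distrib)

lemma tr_0 [simp]: "tr n 0 = 0"
  by (simp add: tr_def power_0_left)

lemma frob_tr: "tr n x ^ 2 ^ k = tr n (x ^ 2 ^ k)"
  by (simp add: tr_def frob_sum frob_frob add.commute)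

lemma tr_split: "tr (m + n) x = tr m x + tr n (x ^ 2 ^ m)"
  unfolding tr_def by (induction n) (simp_all add: frob_frob add.assoc)

lemma tr_frob: assumes "x \<in> gf n" shows "tr n (x ^ 2) = tr n x"
proof -
  have "tr n x + x = tr (Suc n) x" using assms by (simp add: tr_def gf_def)
  also have "\<dots> = x + tr n (x ^ 2)"
    using tr_split[of 1 n x] by (simp add: tr_def)
  finally show ?thesis by (simp add: add.commute)
qed

lemma tr_01: assumes "x \<in> gf n" shows "tr n x = 0 \<or> tr n x = 1"
proof -
  have "tr n x ^ 2 = tr n x" using frob_tr[of n x 1] tr_frob[OF assms] by simp
  thus ?thesis by (simp add: power2_eq_square)
qed

text \<open>The trace is a polynomial map of degree at most 2^(n-1) with linear coefficient 1, so it
  cannot vanish at all 2^n elements.\<close>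

lemma ex_tr_1: assumes "n > 0" obtains x where "x \<in> gf n" "tr n x = 1"
proof -
  define p :: "F2bar poly" where "p = (\<Sum>i<n. Polynomial.monom 1 (2 ^ i))"
  have "\<exists>x\<in>gf n. tr n x \<noteq> 0"
  proof (rule ccontr)
    assume "\<not> ?thesis"
    hence sub: "gf n \<subseteq> {x. poly p x = 0}" by (auto simp: p_def tr_def poly_sum poly_monom)
    have "Polynomial.coeff p 1 = (\<Sum>i<n. if i = 0 then 1 else 0)"
      unfolding p_def by (simp add: Polynomial.coeff_sum)
    hence "p \<noteq> 0" using assms by auto
    have deg: "Polynomial.degree p \<le> 2 ^ (n-1)"
      unfolding p_def by (rule Polynomial.degree_sum_le) (auto intro!: order.trans[OF Polynomial.degree_monom_le])
    have "2 ^ n \<le> card {x. poly p x = 0}"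
      using card_mono[OF poly_roots_finite[OF \<open>p \<noteq> 0\<close>] sub] card_gf[OF assms] by simp
    also have "\<dots> \<le> Polynomial.degree p" by (rule card_poly_roots_bound[OF \<open>p \<noteq> 0\<close>])
    also note deg
    finally show False using assms by simp
  qed
  thus ?thesis using that tr_01 by blast
qed

text \<open>Integer values keep parity arguments available. Off \<open>gf n\<close> the trace may be
  neither 0 nor 1, so multiplicativity is claimed only on \<open>gf n\<close>.\<close>

definition chi :: "nat \<Rightarrow> F2bar \<Rightarrow> int" where
  "chi n x = (if tr n x = 0 then 1 else -1)"

lemma chi_0 [simp]: "chi n 0 = 1"
  by (simp add: chi_def)

lemma chi_add: "x \<in> gf n \<Longrightarrow> y \<in> gf n \<Longrightarrow> chi n (x + y) = chi n x * chi n y"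
  using tr_01[of x n] tr_01[of y n] by (auto simp: chi_def tr_add)

lemma bij_betw_gf_add: "a \<in> gf n \<Longrightarrow> bij_betw (\<lambda>x. x + a) (gf n) (gf n)"
  by (rule bij_betwI[where g = "\<lambda>x. x + a"]) (auto simp: add.assoc)

lemma bij_betw_gf_mult: "a \<in> gf n \<Longrightarrow> a \<noteq> 0 \<Longrightarrow> bij_betw (\<lambda>x. a * x) (gf n - {0}) (gf n - {0})"
  by (rule bij_betwI[where g = "\<lambda>x. inverse a * x"]) (auto simp flip: mult.assoc)

lemma bij_betw_gf_inverse: "bij_betw inverse (gf n - {0}) (gf n - {0})"
  by (rule bij_betwI[where g = inverse]) auto

text \<open>Translation by an element of trace 1 reverses every sign.\<close>

lemma sum_chi: assumes "n > 0" shows "(\<Sum>x\<in>gf n. chi n x) = 0"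
proof -
  obtain b where b: "b \<in> gf n" "tr n b = 1" using ex_tr_1[OF assms] .
  have "(\<Sum>x\<in>gf n. chi n x) = (\<Sum>x\<in>gf n. chi n (x + b))"
    by (rule sum.reindex_bij_betw[OF bij_betw_gf_add[OF b(1)], symmetric])
  also have "\<dots> = (\<Sum>x\<in>gf n. - chi n x)"
    using b by (intro sum.cong) (auto simp: chi_add chi_def[of n b])
  finally show ?thesis by (simp add: sum_negf)
qed

lemma sum_chi_nonzero: assumes "n > 0" shows "(\<Sum>x\<in>gf n - {0}. chi n x) = -1"
  using sum_chi[OF assms] assms by (simp add: sum_diff1)

lemma sum_chi_mult:
  assumes "n > 0" "a \<in> gf n"
  shows "(\<Sum>x\<in>gf n - {0}. chi n (a * x)) = (if a = 0 then 2 ^ n - 1 else -1)"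
proof (cases "a = 0")
  case True
  thus ?thesis using assms card_gf[of n] by (simp add: card_Diff_singleton)
next
  case False
  have "(\<Sum>x\<in>gf n - {0}. chi n (a * x)) = (\<Sum>x\<in>gf n - {0}. chi n x)"
    by (rule sum.reindex_bij_betw[OF bij_betw_gf_mult[OF assms(2) False]])
  thus ?thesis using False sum_chi_nonzero assms by simp
qed

lemma sum_chi_mult_inverse:
  assumes "n > 0" "a \<in> gf n"
  shows "(\<Sum>x\<in>gf n - {0}. chi n (a * inverse x)) = (if a = 0 then 2 ^ n - 1 else -1)"
  using sum_chi_mult[OF assms] sum.reindex_bij_betw[OF bij_betw_gf_inverse, of "\<lambda>x. chi n (a * x)"]
  by simp

definition kloosterman :: "nat \<Rightarrow> F2bar \<Rightarrow> int" where
  "kloosterman n a = (\<Sum>z\<in>gf n - {0}. chi n (a * z + inverse z))"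

section \<open>Kloosterman sums under quadratic extension\<close>

lemma gf_double: "gf n \<subseteq> gf (2 * n)"
  by (rule gf_dvd) simp

lemma frob_gf_double: "w \<in> gf (2 * n) \<Longrightarrow> (w ^ 2 ^ n) ^ 2 ^ n = w"
  by (simp add: frob_frob gf_def mult_2)

lemma tr_double: "tr (2 * n) x = tr n (x + x ^ 2 ^ n)"
  using tr_split[of n n x] by (simp add: mult_2 tr_add)

lemma vieta_ex: obtains u v :: F2bar where "u + v = s" "u * v = p"
proof -
  have "Polynomial.degree [:p, s, 1:] > 0" by simp
  then obtain u where "poly [:p, s, 1:] u = 0" using alg_closed_imp_poly_has_root by blast
  hence u: "p + u * (s + u) = 0" by simp
  show ?thesis
    by (rule that[of u "s + u"]) (use u in \<open>simp_all add: add_eq_0_iff_F2bar add.left_commute\<close>)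
qed

lemma vieta_unique:
  fixes u v x y :: F2bar
  assumes "x + y = u + v" "x * y = u * v"
  shows "x = u \<and> y = v \<or> x = v \<and> y = u"
proof -
  have "(x - u) * (x - v) = x * x - x * (u + v) + u * v" by (simp only: ring_distribs) simp
  also have "\<dots> = x * x - x * (x + y) + x * y" using assms by simp
  also have "\<dots> = 0" by (simp add: algebra_simps)
  finally have "x = u \<or> x = v" by (simp add: add_eq_0_iff_F2bar)
  thus ?thesis using assms(1) by (metis add.commute add_left_cancel)
qed

text \<open>The \<open>2 ^ n\<close>-power map permutes the roots of X^2 + s X + p. If it fixes
  both, there are two ordered pairs, or a single pair for a double root, which then also counts once
  as \<open>w\<close>. If it swaps them, there is no pair and \<open>w\<close> is either
  root.\<close>

lemma count_quadratic:
  assumes n: "n > 0" and s: "s \<in> gf n" and p: "p \<in> gf n" "p \<noteq> 0"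
  shows "card {(x, y) \<in> (gf n - {0}) \<times> (gf n - {0}). x + y = s \<and> x * y = p}
       + card {w \<in> gf (2 * n) - {0}. w + w ^ 2 ^ n = s \<and> w * w ^ 2 ^ n = p} = 2"
    (is "card ?P + card ?W = 2")
proof -
  obtain u v where uv: "u + v = s" "u * v = p" by (rule vieta_ex)
  have nz: "u \<noteq> 0" "v \<noteq> 0" using uv p by auto
  have fuv: "u ^ 2 ^ n + v ^ 2 ^ n = u + v" "u ^ 2 ^ n * v ^ 2 ^ n = u * v"
    using s p uv by (simp_all add: gf_def flip: frob_add power_mult_distrib)
  consider "u ^ 2 ^ n = u" "v ^ 2 ^ n = v" | "u \<noteq> v" "u ^ 2 ^ n = v" "v ^ 2 ^ n = u"
    using vieta_unique[OF fuv] by metis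
  thus ?thesis
  proof cases
    case 1
    have P: "?P = {(u, v), (v, u)}"
      using 1 nz uv vieta_unique[of _ _ u v] by (auto simp: gf_def add.commute mult.commute)
    have W: "?W = (if u = v then {u} else {})"
    proof -
      have "w = u \<and> u = v" if "w + w ^ 2 ^ n = s" "w * w ^ 2 ^ n = p" for w
        using vieta_unique[of w "w ^ 2 ^ n" u v] that uv 1 by auto
      moreover have "u \<in> ?W" if "u = v"
        using that 1 nz uv gf_double[of n] by (auto simp: gf_def)
      ultimately show ?thesis by auto
    qed
    show ?thesis unfolding P W by auto
  next
    case 2
    have False if "x ^ 2 ^ n = x" "x + y = s" "x * y = p" for x y
      using vieta_unique[of x y u v] that uv 2 by metis
    hence P: "?P = {}" by (auto simp: gf_def)
    have W: "?W = {u, v}"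
    proof -
      have mem: "x \<in> gf (2 * n)" if "(x ^ 2 ^ n) ^ 2 ^ n = x" for x
        using that by (simp add: gf_def mult_2 frob_frob)
      have "w = u \<or> w = v" if "w + w ^ 2 ^ n = s" "w * w ^ 2 ^ n = p" for w
        using vieta_unique[of w "w ^ 2 ^ n" u v] that uv by auto
      moreover have "u \<in> ?W" "v \<in> ?W"
        using 2 nz uv mem by (simp_all add: add.commute mult.commute)
      ultimately show ?thesis by blast
    qed
    show ?thesis unfolding P W using 2 by simp
  qed
qed

lemma sum_fiberwise:
  fixes g :: "'b \<Rightarrow> int"
  assumes "finite A" "finite B" "f ` A \<subseteq> B"
  shows "(\<Sum>x\<in>A. g (f x)) = (\<Sum>y\<in>B. int (card {x \<in> A. f x = y}) * g y)"
proof -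
  have "(\<Sum>x\<in>A. g (f x)) = (\<Sum>y\<in>B. \<Sum>x\<in>{x \<in> A. f x = y}. g (f x))"
    using assms by (intro sum.group[symmetric]) auto
  also have "\<dots> = (\<Sum>y\<in>B. \<Sum>x\<in>{x \<in> A. f x = y}. g y)"
    by (intro sum.cong) auto
  finally show ?thesis by simp
qed

text \<open>
  Both \<open>kloosterman n a ^ 2\<close> and \<open>kloosterman (2 * n) a\<close> are sums of the same function
  of trace and norm, over the split and the nonsplit quadratic algebra respectively; each monic
  quadratic polynomial is counted twice in total.
\<close>
lemma kloosterman_double:
  assumes n: "n > 0" and a: "a \<in> gf n" "a \<noteq> 0"
  shows "kloosterman (2 * n) a = 2 * 2 ^ n - kloosterman n a ^ 2"
proof -
  define G where "G = (\<lambda>(s, p). chi n (a * s + s * inverse p))"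
  define P where "P = (gf n - {0}) \<times> (gf n - {0})"
  define W where "W = gf (2 * n) - {0}"
  define B where "B = gf n \<times> (gf n - {0})"
  define f where "f = (\<lambda>(x, y). (x + y, x * y :: F2bar))"
  define h where "h = (\<lambda>w. (w + w ^ 2 ^ n, w * w ^ 2 ^ n :: F2bar))"
  have fin: "finite P" "finite W" "finite B"
    using n by (auto simp: P_def W_def B_def)
  have fB: "f ` P \<subseteq> B" by (auto simp: f_def P_def B_def)
  have hB: "h ` W \<subseteq> B"
  proof
    fix z assume "z \<in> h ` W"
    then obtain w where w: "w \<in> W" "z = h w" by blast
    have "(w ^ 2 ^ n) ^ 2 ^ n = w" using w by (intro frob_gf_double) (simp add: W_def)
    thus "z \<in> B" using w
      by (simp add: B_def W_def h_def gf_def frob_add power_mult_distrib add.commute mult.commute)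
  qed
  have "kloosterman n a ^ 2 = (\<Sum>(x, y)\<in>P. chi n (a * x + inverse x) * chi n (a * y + inverse y))"
    by (simp add: kloosterman_def power2_eq_square sum_product sum.cartesian_product P_def)
  also have "\<dots> = (\<Sum>z\<in>P. G (f z))"
  proof (rule sum.cong[OF refl])
    fix z assume "z \<in> P"
    then obtain x y where z: "z = (x, y)" "x \<in> gf n" "y \<in> gf n" "x \<noteq> 0" "y \<noteq> 0"
      by (auto simp: P_def)
    have "a * (x + y) + (x + y) * inverse (x * y) = (a * x + inverse x) + (a * y + inverse y)"
      using z by (simp add: field_simps)
    moreover have "chi n ((a * x + inverse x) + (a * y + inverse y))
        = chi n (a * x + inverse x) * chi n (a * y + inverse y)"
      using z a by (intro chi_add) auto
    ultimately show "(case z of (x, y) \<Rightarrow> chi n (a * x + inverse x) * chi n (a * y + inverse y)) = G (f z)"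
      by (simp add: z G_def f_def)
  qed
  also have "\<dots> = (\<Sum>b\<in>B. int (card {z \<in> P. f z = b}) * G b)"
    by (rule sum_fiberwise) (use fin fB in auto)
  finally have K1: "kloosterman n a ^ 2 = \<dots>" .
  have "kloosterman (2 * n) a = (\<Sum>w\<in>W. G (h w))"
    unfolding kloosterman_def W_def[symmetric]
  proof (rule sum.cong[OF refl])
    fix w assume "w \<in> W"
    hence w: "w \<noteq> 0" by (simp add: W_def)
    have inverse_sum: "(x + y) * inverse (x * y) = inverse x + inverse y" if "x \<noteq> 0" "y \<noteq> 0" for x y :: F2bar
      using that by (simp add: field_simps)
    have aq: "a ^ 2 ^ n = a" using a by (simp add: gf_def)
    have "a * w + inverse w + (a * w + inverse w) ^ 2 ^ n
        = a * (w + w ^ 2 ^ n) + (w + w ^ 2 ^ n) * inverse (w * w ^ 2 ^ n)"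
      using w inverse_sum[of w "w ^ 2 ^ n"]
      by (simp only: frob_add power_mult_distrib aq power_inverse distrib_left power_not_zero)
        (simp add: add_ac)
    thus "chi (2 * n) (a * w + inverse w) = G (h w)"
      by (simp add: chi_def tr_double G_def h_def)
  qed
  also have "\<dots> = (\<Sum>b\<in>B. int (card {w \<in> W. h w = b}) * G b)"
    by (rule sum_fiberwise) (use fin hB in auto)
  finally have K2: "kloosterman (2 * n) a = \<dots>" .
  have count: "card {z \<in> P. f z = b} + card {w \<in> W. h w = b} = 2" if b: "b \<in> B" for b
  proof -
    obtain s p where sp: "b = (s, p)" "s \<in> gf n" "p \<in> gf n" "p \<noteq> 0"
      using b by (auto simp: B_def)
    have "{z \<in> P. f z = b} = {(x, y) \<in> (gf n - {0}) \<times> (gf n - {0}). x + y = s \<and> x * y = p}"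
      by (auto simp: P_def f_def sp)
    moreover have "{w \<in> W. h w = b} = {w \<in> gf (2 * n) - {0}. w + w ^ 2 ^ n = s \<and> w * w ^ 2 ^ n = p}"
      by (simp add: W_def h_def sp)
    ultimately show ?thesis using count_quadratic[OF n sp(2-4)] by simp
  qed
  have "kloosterman n a ^ 2 + kloosterman (2 * n) a
      = (\<Sum>b\<in>B. int (card {z \<in> P. f z = b} + card {w \<in> W. h w = b}) * G b)"
    unfolding K1 K2 by (simp add: sum.distrib distrib_right)
  also have "\<dots> = (\<Sum>b\<in>B. 2 * G b)"
    by (intro sum.cong refl) (simp add: count)
  also have "\<dots> = 2 * (\<Sum>s\<in>gf n. \<Sum>p\<in>gf n - {0}. G (s, p))"
    by (simp add: B_def sum.cartesian_product sum_distrib_left split_def)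
  \<comment> \<open>For \<open>s \<noteq> 0\<close> the quotient s/p runs through all nonzero
    elements and the inner character sum is -1; only \<open>s = 0\<close> gives a large
    term.\<close>
  also have "(\<Sum>s\<in>gf n. \<Sum>p\<in>gf n - {0}. G (s, p))
      = (\<Sum>s\<in>gf n. chi n (a * s) * (if s = 0 then 2 ^ n - 1 else -1))"
  proof (rule sum.cong[OF refl])
    fix s assume s: "s \<in> gf n"
    have "(\<Sum>p\<in>gf n - {0}. G (s, p)) = (\<Sum>p\<in>gf n - {0}. chi n (a * s) * chi n (s * inverse p))"
      unfolding G_def using s a by (intro sum.cong refl) (auto intro!: chi_add)
    also have "\<dots> = chi n (a * s) * (if s = 0 then 2 ^ n - 1 else -1)"
      by (simp only: sum_chi_mult_inverse[OF n s] flip: sum_distrib_left)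
    finally show "(\<Sum>p\<in>gf n - {0}. G (s, p)) = \<dots>" .
  qed
  also have "\<dots> = (2 ^ n - 1) + (\<Sum>s\<in>gf n - {0}. chi n (a * s) * (-1))"
    using n by (subst sum.remove[of _ 0]) (auto intro!: sum.cong)
  also have "\<dots> = 2 ^ n"
    using sum_chi_mult[OF n a(1)] a(2) by (simp add: sum_negf)
  finally show ?thesis by simp
qed

section \<open>Stepanov's method\<close>

text \<open>Coefficients are confined to a finite field so that polynomials of bounded degree can be
  counted.\<close>

definition gf_polys :: "nat \<Rightarrow> F2bar poly set" where
  "gf_polys n = {p. \<forall>i. Polynomial.coeff p i \<in> gf n}"

lemma gf_polys_0 [simp]: "0 \<in> gf_polys n"
  by (simp add: gf_polys_def)

lemma gf_polys_add [intro]: "p \<in> gf_polys n \<Longrightarrow> q \<in> gf_polys n \<Longrightarrow> p + q \<in> gf_polys n"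
  by (auto simp: gf_polys_def)

lemma gf_polys_mult [intro]: "p \<in> gf_polys n \<Longrightarrow> q \<in> gf_polys n \<Longrightarrow> p * q \<in> gf_polys n"
  by (auto simp: gf_polys_def Polynomial.coeff_mult)

lemma gf_polys_monom [intro]: "c \<in> gf n \<Longrightarrow> Polynomial.monom c i \<in> gf_polys n"
  by (auto simp: gf_polys_def)

lemma gf_polys_power [intro]: "p \<in> gf_polys n \<Longrightarrow> p ^ k \<in> gf_polys n"
proof (induction k)
  case 0
  show ?case using gf_polys_monom[of 1 n 0] by (simp add: monom_eq_1)
qed auto

lemma gf_polys_sum [intro]: "(\<And>i. i \<in> A \<Longrightarrow> f i \<in> gf_polys n) \<Longrightarrow> sum f A \<in> gf_polys n"
  by (induction A rule: infinite_finite_induct) auto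

lemma finite_card_gf_polys:
  assumes "n > 0"
  shows "finite {p \<in> gf_polys n. \<forall>i\<ge>N. Polynomial.coeff p i = 0} \<and>
    card {p \<in> gf_polys n. \<forall>i\<ge>N. Polynomial.coeff p i = 0} \<le> (2 ^ n) ^ N"
    (is "finite ?A \<and> _")
proof -
  let ?f = "\<lambda>p. restrict (Polynomial.coeff p) {..<N}"
  let ?B = "{..<N} \<rightarrow>\<^sub>E gf n"
  have sub: "?f ` ?A \<subseteq> ?B" by (intro image_subsetI) (simp add: gf_polys_def restrict_PiE_iff)
  have inj: "inj_on ?f ?A"
  proof (rule inj_onI)
    fix p q assume pq: "p \<in> ?A" "q \<in> ?A" "?f p = ?f q"
    show "p = q"
    proof (rule Polynomial.poly_eqI)
      fix i show "Polynomial.coeff p i = Polynomial.coeff q i"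
        using pq(1,2) fun_cong[OF pq(3), of i] by (cases "i < N") auto
    qed
  qed
  have fin: "finite ?B" using assms by (intro finite_PiE) auto
  have "finite ?A" by (rule inj_on_finite[OF inj sub fin])
  moreover have "card ?A \<le> card ?B" by (rule card_inj_on_le[OF inj sub fin])
  ultimately show ?thesis using assms by (simp add: card_PiE card_gf)
qed

lemma diff_F2bar_poly [simp]: "p - q = p + (q :: F2bar poly)"
  by (rule Polynomial.poly_eqI) simp

lemma add_self_F2bar_poly [simp]: "p + p = (0 :: F2bar poly)"
  by (metis diff_F2bar_poly diff_self)

text \<open>Counting replaces linear algebra: in the application \<open>T\<close> involves r-th
  powers of the coefficients, so it is additive but not linear. Two assignments with the same image
  are added, which in characteristic two is their difference.\<close>

lemma pigeonhole_additive:
  fixes T :: "('i \<Rightarrow> F2bar) \<Rightarrow> F2bar poly"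
  assumes n: "n > 0" and S: "finite S" "card S > N"
    and add: "\<And>c d. T (\<lambda>i. c i + d i) = T c + T d"
    and range: "\<And>c. (\<And>i. c i \<in> gf n) \<Longrightarrow> T c \<in> gf_polys n \<and> (\<forall>i\<ge>N. Polynomial.coeff (T c) i = 0)"
  obtains c where "\<And>i. c i \<in> gf n" "T c = 0" "\<And>i. i \<notin> S \<Longrightarrow> c i = 0" "\<exists>i\<in>S. c i \<noteq> 0"
proof -
  let ?A = "S \<rightarrow>\<^sub>E gf n"
  let ?e = "\<lambda>c i. if i \<in> S then c i else 0"
  let ?P = "{p \<in> gf_polys n. \<forall>i\<ge>N. Polynomial.coeff p i = 0}"
  have gfA: "?e c i \<in> gf n" if "c \<in> ?A" for c i
    using that by auto
  have sub: "(\<lambda>c. T (?e c)) ` ?A \<subseteq> ?P" 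
  proof (rule image_subsetI)
    fix c assume "c \<in> ?A"
    hence "\<And>i. ?e c i \<in> gf n" by (rule gfA)
    thus "T (?e c) \<in> ?P" using range[of "?e c"] by simp
  qed
  have "card ?P \<le> (2 ^ n) ^ N" using finite_card_gf_polys[OF n] by blast
  also have "\<dots> < (2 ^ n) ^ card S"
    using S n by (intro power_strict_increasing one_less_power) auto
  also have "\<dots> = card ?A"
    using S n by (simp add: card_PiE card_gf)
  finally have "card ((\<lambda>c. T (?e c)) ` ?A) < card ?A"
    using card_mono[OF _ sub] finite_card_gf_polys[OF n, of N] by linarith
  hence "\<not> inj_on (\<lambda>c. T (?e c)) ?A" by (rule pigeonhole)
  then obtain c d where cd: "c \<in> ?A" "d \<in> ?A" "T (?e c) = T (?e d)" "c \<noteq> d"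
    unfolding inj_on_def by blast
  then obtain i where i: "i \<in> S" "c i \<noteq> d i" by (meson PiE_ext)
  show ?thesis
  proof (rule that[of "\<lambda>i. ?e c i + ?e d i"])
    show "\<exists>i\<in>S. ?e c i + ?e d i \<noteq> 0"
      using i by (intro bexI[of _ i]) (simp_all add: add_eq_0_iff_F2bar)
    show "T (\<lambda>i. ?e c i + ?e d i) = 0" unfolding add using cd(3) by simp
    show "?e c i + ?e d i \<in> gf n" for i using gfA[OF cd(1)] gfA[OF cd(2)] by (rule gf_add)
  qed simp
qed


text \<open>
  Stepanov's method. Write $r = 2^k$, $h = r/2$, so that the field has $r^2$ elements. The auxiliary
  polynomial is $A = x^h C_0 + H C_1$, where $C_0$ and $C_1$ have the coefficients
  \<open>c\<close> at the exponents $i + r j$. On the set to be bounded, $A^r$ equals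
  $x^{h r}$ times $E_0 + (\varphi + 1) E_1$, which has much smaller degree because
  $x^{r^2} = x$; counting coefficients, \<open>c\<close> can be chosen so that it vanishes identically.
\<close>
lemma stepanov:
  fixes H :: "F2bar poly" and \<phi> :: "F2bar \<Rightarrow> F2bar"
  assumes k: "k \<ge> 2"
    and H: "H \<in> gf_polys (2 * k)" "Polynomial.degree H = 2 ^ k"
    and M: "\<And>x. x \<in> M \<Longrightarrow> x \<in> gf (2 * k) \<and> x \<noteq> 0"
      "\<And>x. x \<in> M \<Longrightarrow> poly H x = x ^ 2 ^ (k - 1) * \<phi> x"
      "\<And>x. x \<in> M \<Longrightarrow> \<phi> x ^ 2 ^ k = \<phi> x + 1"
  shows "2 * card M \<le> 2 ^ (2 * k) + 3 * 2 ^ k"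
proof -
  define g r h :: nat where "g = 2 ^ (k - 2)" and "r = 2 ^ k" and "h = 2 ^ (k - 1)"
  obtain k' where k': "k = Suc (Suc k')" using k by (metis add_2_eq_Suc le_Suc_ex)
  have rg: "r = 4 * g" and hg: "h = 2 * g" and g: "g > 0"
    by (simp_all add: g_def r_def h_def k')
  define IJ where "IJ = {..<g + 1} \<times> {..<h + 1}"
  define C where "C = (\<lambda>(c :: bool \<times> nat \<times> nat \<Rightarrow> F2bar) b.
    \<Sum>(i, j)\<in>IJ. Polynomial.monom (c (b, i, j)) (i + r * j))"
  \<comment> \<open>The r-th power of \<open>C c b\<close> as a function on the field of r^2
    elements: (x^(i + r j))^r = x^(r i + j), because x^(r r) = x.\<close>
  define E where "E = (\<lambda>(c :: bool \<times> nat \<times> nat \<Rightarrow> F2bar) b.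
    \<Sum>(i, j)\<in>IJ. Polynomial.monom (c (b, i, j) ^ r) (r * i + j))"
  define W where "W = (Polynomial.monom 1 h :: F2bar poly)"
  \<comment> \<open>In the application \<open>\<phi>\<close> has a pole at 0. Clearing it by x^h,
    the polynomial \<open>H + W\<close> represents x^h (\<open>\<phi>\<close> + 1) on
    \<open>M\<close>.\<close>
  define L where "L = (\<lambda>c. W * E c False + (H + W) * E c True)"
  define N where "N = r * (g + 1) + h + 1"
  have finIJ [simp]: "finite IJ" by (simp add: IJ_def)
  have H0: "H \<noteq> 0" using H(2) by auto
  have degW: "Polynomial.degree W = h" by (simp add: W_def Polynomial.degree_monom_eq)
  have W_gf: "W \<in> gf_polys (2 * k)" by (auto simp: W_def)
  obtain c where c: "\<And>i. c i \<in> gf (2 * k)" "L c = 0"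
      "\<exists>i\<in>UNIV \<times> IJ. c i \<noteq> 0"
  proof (rule pigeonhole_additive[of "2 * k" "(UNIV :: bool set) \<times> IJ" N L])
    \<comment> \<open>The choice g = r/4, h = r/2 is just sufficient: 2 (g + 1) (2 g + 1) = 4 g^2 +
      6 g + 2 unknowns against N = 4 g^2 + 6 g + 1 coefficients.\<close>
    show "N < card ((UNIV :: bool set) \<times> IJ)"
      by (simp add: N_def IJ_def card_cartesian_product rg hg algebra_simps)
    show "L (\<lambda>i. c i + d i) = L c + L d" for c d
    proof -
      have "E (\<lambda>i. c i + d i) b = E c b + E d b" for b
        by (simp add: E_def r_def frob_add split_def sum.distrib flip: add_monom)
      thus ?thesis by (simp add: L_def algebra_simps)
    qed
    show "L c \<in> gf_polys (2 * k) \<and> (\<forall>i\<ge>N. Polynomial.coeff (L c) i = 0)"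
      if c: "\<And>i. c i \<in> gf (2 * k)" for c
    proof
      have E: "E c b \<in> gf_polys (2 * k)" for b
        unfolding E_def split_def by (intro gf_polys_sum gf_polys_monom gf_power c)
      thus "L c \<in> gf_polys (2 * k)"
        unfolding L_def by (intro gf_polys_add gf_polys_mult W_gf H)
      have degE: "Polynomial.degree (E c b) \<le> r * g + h" for b
        unfolding E_def
      proof (rule Polynomial.degree_sum_le)
        fix p assume "p \<in> IJ"
        then obtain i j where p: "p = (i, j)" "i \<le> g" "j \<le> h" by (auto simp: IJ_def)
        have "r * i + j \<le> r * g + h" using p by (intro add_mono mult_left_mono) auto
        thus "Polynomial.degree (case p of (i, j) \<Rightarrow> Polynomial.monom (c (b, i, j) ^ r) (r * i + j)) \<le> r * g + h"
          unfolding p by (auto intro: order.trans[OF Polynomial.degree_monom_le])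
      qed simp
      have "Polynomial.degree (W * E c False) \<le> r + (r * g + h)"
        using degE[of False] degW by (intro order.trans[OF Polynomial.degree_mult_le]) (simp add: rg hg)
      moreover have "Polynomial.degree (H + W) \<le> r"
        by (rule Polynomial.degree_add_le) (simp_all add: H degW r_def h_def)
      hence "Polynomial.degree ((H + W) * E c True) \<le> r + (r * g + h)"
        using degE[of True] by (intro order.trans[OF Polynomial.degree_mult_le] add_mono)
      ultimately have "Polynomial.degree (L c) \<le> r + (r * g + h)"
        unfolding L_def by (rule Polynomial.degree_add_le)
      also have "\<dots> < N" by (simp add: N_def)
      finally show "\<forall>i\<ge>N. Polynomial.coeff (L c) i = 0"
        by (auto intro: Polynomial.coeff_eq_0)
    qed
  qed (use k in auto)
  \<comment> \<open>On \<open>M\<close>, \<open>A\<close> is x^h times an r-th root of the factor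
    that \<open>L c\<close> multiplies by x^h. Vanishing passes from the power to its root, which
    takes the place of a high order of vanishing.\<close>
  define A where "A = W * C c False + H * C c True"
  have coeff_C: "Polynomial.coeff (C c b) m = (\<Sum>(i, j)\<in>IJ. if i + r * j = m then c (b, i, j) else 0)" for b m
    unfolding C_def Polynomial.coeff_sum by (intro sum.cong) auto
  have residue: "m mod r \<le> g" if "Polynomial.coeff (C c b) m \<noteq> 0" for b m
  proof -
    have "\<exists>i j. i \<le> g \<and> m = i + r * j"
    proof (rule ccontr)
      assume "\<not> ?thesis"
      hence "Polynomial.coeff (C c b) m = 0" unfolding coeff_C by (intro sum.neutral) (auto simp: IJ_def less_Suc_eq_le)
      thus False using that by simp
    qed
    then obtain i j where "i \<le> g" "m = i + r * j" by blast
    thus ?thesis by (simp add: order.trans[OF mod_less_eq_dividend])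
  qed
  have nonzero: "C c b \<noteq> 0" if "(i, j) \<in> IJ" "c (b, i, j) \<noteq> 0" for b i j
  proof -
    have eq: "i' + r * j' = i + r * j \<longleftrightarrow> (i', j') = (i, j)" if "(i', j') \<in> IJ" for i' j'
    proof
      assume eq: "i' + r * j' = i + r * j"
      have "i' < r" "i < r" using that \<open>(i, j) \<in> IJ\<close> g by (auto simp: IJ_def rg)
      hence "i' = (i' + r * j') mod r" "i = (i + r * j) mod r" by simp_all
      hence "i' = i" using eq by simp
      thus "(i', j') = (i, j)" using eq g by (simp add: rg)
    qed simp
    have "Polynomial.coeff (C c b) (i + r * j) = (\<Sum>p\<in>IJ. if p = (i, j) then c (b, i, j) else 0)"
      unfolding coeff_C by (rule sum.cong) (use eq in \<open>auto split: if_splits\<close>)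
    also have "\<dots> = c (b, i, j)" using that by simp
    finally show ?thesis using that by auto
  qed
  obtain b i j where "(i, j) \<in> IJ" "c (b, i, j) \<noteq> 0"
    using c(3) by force
  hence C0: "C c False \<noteq> 0 \<or> C c True \<noteq> 0"
    using nonzero[of i j b] by (cases b) auto
  \<comment> \<open>The two summands differ in degree modulo r: h + deg C0 leaves a remainder
    between h and h + g < r, while r + deg C1 leaves one of at most g < h.\<close>
  have A0: "A \<noteq> 0"
  proof
    assume "A = 0"
    hence eq: "W * C c False = H * C c True"
      by (metis A_def diff_F2bar_poly eq_iff_diff_eq_0)
    have "W \<noteq> 0" using degW g by (auto simp: W_def)
    hence nz: "C c False \<noteq> 0" "C c True \<noteq> 0" using C0 eq H0 by auto
    define d0 d1 where "d0 = Polynomial.degree (C c False)" and "d1 = Polynomial.degree (C c True)"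
    have res: "d0 mod r \<le> g" "d1 mod r \<le> g"
      using residue[of False d0] residue[of True d1] nz by (auto simp: d0_def d1_def)
    have "h + d0 = r + d1"
      using arg_cong[OF eq, of Polynomial.degree] \<open>W \<noteq> 0\<close> H0 nz degW H(2)
      by (simp add: Polynomial.degree_mult_eq d0_def d1_def r_def)
    hence "(h + d0 mod r) mod r = d1 mod r"
      by (metis mod_add_right_eq mod_add_self1)
    moreover have "h + d0 mod r < r" using res(1) g by (simp add: hg rg)
    ultimately show False using res(2) g by (simp add: hg)
  qed
  have "M \<subseteq> {x. poly A x = 0}"
  proof
    fix x assume x: "x \<in> M"
    have xr: "(x ^ (r * j)) ^ r = x ^ j" for j
    proof -
      have "(x ^ (r * j)) ^ r = (x ^ (r * r)) ^ j"
        by (simp add: mult_ac flip: power_mult)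
      moreover have "r * r = 2 ^ (2 * k)" by (simp add: r_def mult_2 power_add)
      ultimately show ?thesis using M(1)[OF x] by (simp add: gf_def)
    qed
    have "poly (C c b) x ^ r = poly (E c b) x" for b
      by (simp add: C_def E_def split_def poly_sum poly_monom frob_sum[of _ _ k, folded r_def]
          power_mult_distrib power_add xr) (simp add: mult.commute flip: power_mult)
    hence "(poly (C c False) x + \<phi> x * poly (C c True) x) ^ r
        = poly (E c False) x + (\<phi> x + 1) * poly (E c True) x"
      using M(3)[OF x] by (simp add: r_def frob_add power_mult_distrib)
    moreover have "poly (L c) x = x ^ h * (poly (E c False) x + (\<phi> x + 1) * poly (E c True) x)"
      using M(2)[OF x] by (simp add: L_def W_def poly_monom h_def algebra_simps)
    ultimately have "poly (C c False) x + \<phi> x * poly (C c True) x = 0"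
      using c(2) M(1)[OF x] by (simp add: r_def)
    moreover have "poly A x = x ^ h * (poly (C c False) x + \<phi> x * poly (C c True) x)"
      using M(2)[OF x] by (simp add: A_def W_def poly_monom h_def algebra_simps)
    ultimately show "x \<in> {x. poly A x = 0}" by simp
  qed
  hence "card M \<le> card {x. poly A x = 0}"
    by (rule card_mono[OF poly_roots_finite[OF A0]])
  also have "\<dots> \<le> Polynomial.degree A" by (rule card_poly_roots_bound[OF A0])
  \<comment> \<open>The main term r h = r^2 / 2 is half the size of the field.\<close>
  also have "\<dots> \<le> r + (g + r * h)"
  proof -
    have degC: "Polynomial.degree (C c b) \<le> g + r * h" for b
      unfolding C_def
    proof (rule Polynomial.degree_sum_le)
      fix p assume "p \<in> IJ"
      then obtain i j where p: "p = (i, j)" "i \<le> g" "j \<le> h" by (auto simp: IJ_def)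
      have "i + r * j \<le> g + r * h" using p by (intro add_mono mult_left_mono) auto
      thus "Polynomial.degree (case p of (i, j) \<Rightarrow> Polynomial.monom (c (b, i, j)) (i + r * j)) \<le> g + r * h"
        unfolding p by (auto intro: order.trans[OF Polynomial.degree_monom_le])
    qed simp
    have "Polynomial.degree (W * C c False) \<le> r + (g + r * h)"
      using degC[of False] degW by (intro order.trans[OF Polynomial.degree_mult_le]) (simp add: rg hg)
    moreover have "Polynomial.degree (H * C c True) \<le> r + (g + r * h)"
      using degC[of True] H by (intro order.trans[OF Polynomial.degree_mult_le]) (simp add: r_def)
    ultimately show ?thesis unfolding A_def by (rule Polynomial.degree_add_le)
  qed
  finally have "2 * card M \<le> 2 * r + h + r * r" by (simp add: hg rg)
  also have "\<dots> \<le> r * r + 3 * r" by (simp add: hg rg)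
  finally show ?thesis by (simp add: r_def mult_2 power_add)
qed

section \<open>The sharp bound and positivity\<close>

text \<open>An upper bound for the number of arguments of trace 1 becomes a lower bound for the sum;
  the parity can be read off as well.\<close>

lemma kloosterman_card:
  assumes "n > 0" "a \<in> gf n"
  shows "kloosterman n a = 2 ^ n - 1 - 2 * int (card {z \<in> gf n - {0}. tr n (a * z + inverse z) = 1})"
proof -
  let ?f = "\<lambda>z. a * z + inverse z"
  have "chi n (?f z) = 1 - 2 * of_bool (tr n (?f z) = 1)" if "z \<in> gf n" for z
    using tr_01[of "?f z" n] that assms by (auto simp: chi_def)
  hence "kloosterman n a = (\<Sum>z\<in>gf n - {0}. 1 - 2 * of_bool (tr n (?f z) = 1))"
    unfolding kloosterman_def by (intro sum.cong) auto
  also have "\<dots> = int (card (gf n - {0})) - 2 * (\<Sum>z\<in>gf n - {0}. of_bool (tr n (?f z) = 1))"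
    by (simp add: sum_subtractf sum_distrib_left)
  also have "(\<Sum>z\<in>gf n - {0}. of_bool (tr n (?f z) = 1)) = int (card {z \<in> gf n - {0}. tr n (?f z) = 1})"
    using assms by (simp add: of_bool_def sum.If_cases Int_def)
  also have "int (card (gf n - {0})) = 2 ^ n - 1"
    using assms by (simp add: card_Diff_singleton card_gf)
  finally show ?thesis .
qed

lemma odd_kloosterman: "n > 0 \<Longrightarrow> a \<in> gf n \<Longrightarrow> odd (kloosterman n a)"
  by (simp add: kloosterman_card)

text \<open>With the half trace \<open>\<phi>\<close> of length k, the trace of degree 2k is
  \<open>\<phi>\<close> + \<open>\<phi>\<close>^(2^k), so \<open>\<phi>\<close>^(2^k) =
  \<open>\<phi>\<close> + 1 wherever that trace is 1. The constant arises from 2 card M \<le> 2^(2k)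
  + 3 * 2^k in \<open>kloosterman_card\<close>.\<close>

lemma kloosterman_lower_bound:
  assumes k: "k \<ge> 2" and a: "a \<in> gf (2 * k)" "a \<noteq> 0"
  shows "- kloosterman (2 * k) a \<le> 3 * 2 ^ k + 1"
proof -
  define M where "M = {z \<in> gf (2 * k) - {0}. tr (2 * k) (a * z + inverse z) = 1}"
  define \<phi> where "\<phi> = (\<lambda>x. tr k (a * x + inverse x))"
  \<comment> \<open>This is x^(2^(k-1)) (a x + 1/x)^(2^i) with denominators cleared. As
    \<open>a \<noteq> 0\<close>, its degree is 2^(k-1) + 2^i, and only i = k - 1 reaches
    2^k.\<close>
  define s where "s = (\<lambda>i. Polynomial.monom 1 (2 ^ (k - 1) - 2 ^ i) * [:1, 0, a:] ^ 2 ^ i)"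
  define H where "H = (\<Sum>i<k. s i)"
  have le: "(2::nat) ^ i \<le> 2 ^ (k - 1)" if "i < k" for i
    using that by (intro power_increasing) auto
  have deg_s: "Polynomial.degree (s i) = 2 ^ (k - 1) + 2 ^ i" if "i < k" for i
    using a le[OF that] unfolding s_def
    by (subst Polynomial.degree_mult_eq) (auto simp: Polynomial.degree_monom_eq Polynomial.degree_power_eq)
  obtain k' where k': "k = Suc k'" "k' > 0" using k by (cases k) auto
  have "2 * card M \<le> 2 ^ (2 * k) + 3 * 2 ^ k"
  proof (rule stepanov[OF k, of H _ \<phi>])
    have "[:1, 0, a:] \<in> gf_polys (2 * k)"
      using a by (auto simp: gf_polys_def Polynomial.coeff_pCons split: nat.splits)
    thus "H \<in> gf_polys (2 * k)"
      unfolding H_def s_def by (intro gf_polys_sum gf_polys_mult gf_polys_power gf_polys_monom gf_1)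
    have "Polynomial.degree (\<Sum>i<k'. s i) \<le> 2 ^ k' + 2 ^ (k' - 1)"
    proof (rule Polynomial.degree_sum_le)
      fix i assume "i \<in> {..<k'}"
      hence "(2::nat) ^ i \<le> 2 ^ (k' - 1)" by (intro power_increasing) auto
      thus "Polynomial.degree (s i) \<le> 2 ^ k' + 2 ^ (k' - 1)"
        using deg_s[of i] \<open>i \<in> _\<close> by (simp add: k')
    qed simp
    also have "\<dots> < Polynomial.degree (s k')"
      using k' by (simp add: deg_s)
    finally show "Polynomial.degree H = 2 ^ k"
      by (simp add: H_def k' Polynomial.degree_add_eq_right deg_s)
    show "x \<in> gf (2 * k) \<and> x \<noteq> 0" if "x \<in> M" for x
      using that by (simp add: M_def)
    show "poly H x = x ^ 2 ^ (k - 1) * \<phi> x" if "x \<in> M" for x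
    proof -
      have x: "x \<noteq> 0" using that by (simp add: M_def)
      have "x ^ (2 ^ (k - 1) - 2 ^ i) * (1 + x * (x * a)) ^ 2 ^ i
          = x ^ 2 ^ (k - 1) * (a * x + inverse x) ^ 2 ^ i" if "i < k" for i
      proof -
        have "1 + x * (x * a) = x * (a * x + inverse x)" using x by (simp add: algebra_simps)
        hence "(1 + x * (x * a)) ^ 2 ^ i = x ^ 2 ^ i * (a * x + inverse x) ^ 2 ^ i"
          by (simp only: power_mult_distrib)
        thus ?thesis using le[OF that] by (simp flip: mult.assoc power_add)
      qed
      thus ?thesis
        by (simp add: H_def s_def \<phi>_def tr_def poly_sum poly_monom sum_distrib_left)
    qed
    show "\<phi> x ^ 2 ^ k = \<phi> x + 1" if "x \<in> M" for x
    proof -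
      have "\<phi> x + \<phi> x ^ 2 ^ k = 1"
        using that by (simp add: M_def \<phi>_def frob_tr mult_2 flip: tr_split)
      thus ?thesis by (metis add_self_left_F2bar)
    qed
  qed
  hence "int (2 * card M) \<le> int (2 ^ (2 * k) + 3 * 2 ^ k)"
    by (simp only: of_nat_le_iff)
  thus ?thesis using k a by (simp add: kloosterman_card M_def)
qed

text \<open>Any value outside [-1, 1] is sent above 1, and from there c - 1 is multiplied by 2 (c +
  1) > 2. Hence an upper bound, even one valid only late in the sequence, is contradicted.\<close>

lemma chebyshev_unbounded:
  fixes c :: "nat \<Rightarrow> real"
  assumes step: "\<And>j. c (Suc j) = 2 * c j ^ 2 - 1" and bound: "\<And>j. j \<ge> J \<Longrightarrow> c j \<le> B"
  shows "\<bar>c 0\<bar> \<le> 1"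
proof (rule ccontr)
  assume "\<not> ?thesis"
  hence "c 0 ^ 2 > 1" by (simp add: abs_square_le_1 flip: not_le)
  hence c1: "c 1 > 1" by (simp add: step)
  have grow: "c (Suc j) - 1 \<ge> 2 ^ j * (c 1 - 1)" for j
  proof (induction j)
    case (Suc j)
    let ?x = "c (Suc j)"
    have x: "?x \<ge> 1" using Suc c1 by (smt (verit) mult_nonneg_nonneg zero_le_power)
    have "c (Suc (Suc j)) - 1 = 2 * (?x - 1) * (?x + 1)"
      by (simp add: step[of "Suc j"] power2_eq_square algebra_simps)
    also have "\<dots> \<ge> 2 * (?x - 1) * 1" using x by (intro mult_left_mono) auto
    finally show ?case using Suc by simp
  qed simp
  obtain n where n: "(B - 1) / (c 1 - 1) < 2 ^ n"
    using real_arch_pow[of 2] by auto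
  hence "B - 1 < 2 ^ n * (c 1 - 1)"
    using c1 by (simp add: pos_divide_less_eq)
  moreover have "2 ^ n * (c 1 - 1) \<le> 2 ^ (n + J) * (c 1 - 1)"
    using c1 by (intro mult_right_mono power_increasing) auto
  ultimately show False
    using grow[of "n + J"] bound[of "Suc (n + J)"] by linarith
qed

text \<open>Each step multiplies 1 - c by 2 (1 + c), which is at least 2 while c is nonnegative, yet
  1 - c then never exceeds 1.\<close>

lemma chebyshev_nonneg:
  fixes c :: "nat \<Rightarrow> real"
  assumes step: "\<And>j. c (Suc j) = 2 * c j ^ 2 - 1" and bound: "\<bar>c J\<bar> \<le> 1"
    and nonneg: "\<And>j. j \<ge> J \<Longrightarrow> c j \<ge> 0"
  shows "c J = 1"
proof (rule ccontr)
  assume "c J \<noteq> 1"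
  hence pos: "1 - c J > 0" using bound by auto
  have grow: "1 - c (J + j) \<ge> 2 ^ j * (1 - c J)" for j
  proof (induction j)
    case (Suc j)
    let ?x = "c (J + j)"
    have "1 - ?x \<ge> 0" using Suc pos by (smt (verit) mult_nonneg_nonneg zero_le_power)
    hence "2 * (1 - ?x) * 1 \<le> 2 * (1 - ?x) * (1 + ?x)"
      using nonneg[of "J + j"] by (intro mult_left_mono) auto
    also have "\<dots> = 1 - c (J + Suc j)"
      by (simp add: step[of "J + j"] power2_eq_square algebra_simps)
    finally show ?case using Suc by simp
  qed simp
  obtain n where "1 / (1 - c J) < 2 ^ n" using real_arch_pow[of 2] by auto
  hence "1 < 2 ^ n * (1 - c J)" using pos by (simp add: pos_divide_less_eq)
  thus False using grow[of n] nonneg[of "J + n"] by linarith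
qed

text \<open>Despite the name, the cosine of the Frobenius angle. For nonzero \<open>a\<close> the
  sum is minus the sum of two Frobenius eigenvalues with product 2^n; a quadratic extension squares
  them and so doubles the angle.\<close>

definition kl_angle :: "nat \<Rightarrow> F2bar \<Rightarrow> real" where
  "kl_angle n a = - real_of_int (kloosterman n a) / (2 * sqrt (2 ^ n))"

lemma sqrt_two_power_double: "sqrt (2 ^ (2 * n)) = 2 ^ n"
proof -
  have "(2::real) ^ (2 * n) = (2 ^ n)\<^sup>2" by (simp add: mult.commute flip: power_mult)
  thus ?thesis by simp
qed

lemma kl_angle_double:
  assumes "n > 0" "a \<in> gf n" "a \<noteq> 0"
  shows "kl_angle (2 * n) a = 2 * kl_angle n a ^ 2 - 1"
  unfolding kl_angle_def kloosterman_double[OF assms] sqrt_two_power_double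
  by (simp add: power_mult_distrib power_divide field_simps)

lemma gf_mult_two_power: "a \<in> gf n \<Longrightarrow> a \<in> gf (n * 2 ^ j)"
  using gf_dvd[of n "n * 2 ^ j"] by auto

text \<open>
  The lower bound only has the constant $3$ in place of $2$, but a violation of the sharp bound
  would be amplified without limit along the tower of quadratic extensions.
\<close>
lemma abs_kl_angle_le_1:
  assumes n: "n > 0" and a: "a \<in> gf n" "a \<noteq> 0"
  shows "\<bar>kl_angle n a\<bar> \<le> 1"
proof -
  define c where "c = (\<lambda>j. kl_angle (n * 2 ^ j) a)"
  have "\<bar>c 0\<bar> \<le> 1"
  \<comment> \<open>\<open>J = 2\<close> makes the degree 2k with k \<ge> 2 even for n = 1;
    \<open>B = 2\<close> comes from 3 * 2^k + 1 \<le> 4 * 2^k.\<close>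
  proof (rule chebyshev_unbounded[where B = 2 and J = 2])
    show "c (Suc j) = 2 * c j ^ 2 - 1" for j
      using kl_angle_double[of "n * 2 ^ j" a] n a gf_mult_two_power[OF a(1), of j]
      by (simp add: c_def mult_ac)
    show "c j \<le> 2" if j: "j \<ge> 2" for j
    proof -
      define k where "k = n * 2 ^ (j - 1)"
      have nk: "n * 2 ^ j = 2 * k" using j by (cases j) (auto simp: k_def)
      have "1 * 2 ^ 1 \<le> k"
        unfolding k_def using n j by (intro mult_mono power_increasing) auto
      hence "- kloosterman (2 * k) a \<le> 3 * 2 ^ k + 1"
        using a gf_mult_two_power[OF a(1), of j] nk by (intro kloosterman_lower_bound) auto
      hence "- kloosterman (2 * k) a \<le> 4 * 2 ^ k"
        using one_le_power[of "2::int" k] by linarith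
      hence "real_of_int (- kloosterman (2 * k) a) \<le> real_of_int (4 * 2 ^ k)"
        by (simp only: of_int_le_iff)
      hence "- real_of_int (kloosterman (2 * k) a) / (2 * 2 ^ k) \<le> 4 * 2 ^ k / (2 * 2 ^ k)"
        by (intro divide_right_mono) auto
      thus ?thesis unfolding c_def nk kl_angle_def sqrt_two_power_double by simp
    qed
  qed
  thus ?thesis by (simp add: c_def)
qed

lemma kloosterman_weil:
  assumes "n > 0" "a \<in> gf n" "a \<noteq> 0"
  shows "\<bar>real_of_int (kloosterman n a)\<bar> \<le> 2 * sqrt (2 ^ n)"
  using abs_kl_angle_le_1[OF assms] by (simp add: kl_angle_def abs_mult field_simps)

lemma infinite_kloosterman_pos: "infinite {n. n > 0 \<and> kloosterman n 1 > 0}"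
proof
  assume fin: "finite {n. n > 0 \<and> kloosterman n 1 > 0}"
  then obtain J where J: "\<And>n. n > 0 \<Longrightarrow> kloosterman n 1 > 0 \<Longrightarrow> n \<le> J"
    unfolding finite_nat_set_iff_bounded_le by auto
  define c where "c = (\<lambda>j. kl_angle (2 ^ j) 1)"
  \<comment> \<open>At \<open>Suc J\<close> the field degree is even, so the square root of the
    order is an integer and c = 1 would make the Kloosterman sum even.\<close>
  have cJ: "c (Suc J) = 1"
  proof (rule chebyshev_nonneg)
    show "c (Suc j) = 2 * c j ^ 2 - 1" for j
      using kl_angle_double[of "2 ^ j" 1] by (simp add: c_def)
    show "\<bar>c (Suc J)\<bar> \<le> 1" by (simp add: c_def abs_kl_angle_le_1 del: power_Suc)
    show "c j \<ge> 0" if "j \<ge> Suc J" for j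
    proof -
      have "(2::nat) ^ j > J" using that less_exp[of j] by linarith
      hence "kloosterman (2 ^ j) 1 \<le> 0" using J[of "2 ^ j"] by force
      thus ?thesis unfolding c_def kl_angle_def by (intro divide_nonneg_nonneg) auto
    qed
  qed
  define n :: nat where "n = 2 ^ J"
  have "kl_angle (2 * n) 1 = 1" using cJ by (simp add: c_def n_def)
  hence "real_of_int (- kloosterman (2 * n) 1) = real_of_int (2 * 2 ^ n)"
    unfolding kl_angle_def sqrt_two_power_double by (simp add: divide_eq_eq)
  hence "- kloosterman (2 * n) 1 = 2 * 2 ^ n"
    by (simp only: of_int_eq_iff)
  hence "even (kloosterman (2 * n) 1)" by (metis dvd_minus_iff dvd_triv_left)
  thus False using odd_kloosterman[of "2 * n" 1] by (simp add: n_def)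
qed

section \<open>Spectrum of the Cayley graph\<close>

definition conn_set :: "nat \<Rightarrow> F2bar set" where
  "conn_set n = {z \<in> gf n. z \<noteq> 0 \<and> tr n z = 1 \<and> tr n (inverse z) = 1}"

definition char_eig :: "nat \<Rightarrow> F2bar \<Rightarrow> int" where
  "char_eig n a = (\<Sum>z\<in>conn_set n. chi n (a * z))"

lemma conn_set_subset: "conn_set n \<subseteq> gf n"
  by (auto simp: conn_set_def)

lemma kloosterman_0: "n > 0 \<Longrightarrow> kloosterman n 0 = -1"
  using sum_chi_mult_inverse[of n 1] by (simp add: kloosterman_def)

text \<open>The product (1 - chi n z) (1 - chi n (inverse z)) is 4 on \<open>conn_set n\<close> and
  0 at all other nonzero elements. Expanding it gives two complete sums and two Kloosterman
  sums.\<close>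

lemma char_eig_eq:
  assumes n: "n > 0" and a: "a \<in> gf n"
  shows "4 * char_eig n a = (if a = 0 then 2 ^ n - 1 else -1) - (if a = 1 then 2 ^ n - 1 else -1)
    - kloosterman n a + kloosterman n (a + 1)"
proof -
  let ?S = "gf n - {0}"
  have sub: "conn_set n \<subseteq> ?S" by (auto simp: conn_set_def)
  have "4 * char_eig n a = (\<Sum>z\<in>conn_set n. chi n (a * z) * (1 - chi n z) * (1 - chi n (inverse z)))"
    by (simp add: char_eig_def sum_distrib_left) (rule sum.cong, auto simp: conn_set_def chi_def)
  also have "\<dots> = (\<Sum>z\<in>?S. chi n (a * z) * (1 - chi n z) * (1 - chi n (inverse z)))"
  proof (rule sum.mono_neutral_left[OF _ sub], use n in simp, intro ballI)
    fix z assume z: "z \<in> ?S - conn_set n"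
    hence "tr n z = 0 \<or> tr n (inverse z) = 0"
      using tr_01[of z n] tr_01[of "inverse z" n] by (auto simp: conn_set_def)
    thus "chi n (a * z) * (1 - chi n z) * (1 - chi n (inverse z)) = 0" by (auto simp: chi_def)
  qed
  also have "\<dots> = (\<Sum>z\<in>?S. chi n (a * z) - chi n ((a + 1) * z) - chi n (a * z + inverse z)
      + chi n ((a + 1) * z + inverse z))"
  proof (rule sum.cong[OF refl])
    fix z assume "z \<in> ?S"
    hence z: "z \<in> gf n" "inverse z \<in> gf n" "a * z \<in> gf n" using a by auto
    have "chi n ((a + 1) * z) = chi n (a * z) * chi n z"
      "chi n (a * z + inverse z) = chi n (a * z) * chi n (inverse z)"
      "chi n ((a + 1) * z + inverse z) = chi n (a * z) * chi n z * chi n (inverse z)"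
      using z by (simp_all add: chi_add gf_add distrib_right)
    thus "chi n (a * z) * (1 - chi n z) * (1 - chi n (inverse z)) = chi n (a * z) - chi n ((a + 1) * z)
        - chi n (a * z + inverse z) + chi n ((a + 1) * z + inverse z)"
      by (simp add: algebra_simps)
  qed
  also have "\<dots> = (\<Sum>z\<in>?S. chi n (a * z)) - (\<Sum>z\<in>?S. chi n ((a + 1) * z))
      - kloosterman n a + kloosterman n (a + 1)"
    by (simp add: sum.distrib sum_subtractf kloosterman_def)
  finally show ?thesis
    using sum_chi_mult[OF n a] sum_chi_mult[OF n gf_add[OF a gf_1]] by (simp add: add_eq_0_iff_F2bar)
qed

lemma char_eig_0: "n > 0 \<Longrightarrow> char_eig n 0 = int (card (conn_set n))"
  by (simp add: char_eig_def)

lemma card_conn_set: "n > 0 \<Longrightarrow> 4 * int (card (conn_set n)) = 2 ^ n + 1 + kloosterman n 1"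
  using char_eig_eq[of n 0] by (simp add: char_eig_0 kloosterman_0)

text \<open>All of \<open>conn_set n\<close> has trace 1, so the character with a = 1 is constantly
  -1 there: the graph is bipartite along the trace.\<close>

lemma char_eig_1: "n > 0 \<Longrightarrow> char_eig n 1 = - int (card (conn_set n))"
  using char_eig_eq[of n 1] card_conn_set[of n] by (simp add: kloosterman_0)

lemma char_eig_le:
  assumes "n > 0" "a \<in> gf n" "a \<noteq> 0" "a \<noteq> 1"
  shows "real_of_int (char_eig n a) \<le> sqrt (2 ^ n)"
proof -
  have "4 * char_eig n a = kloosterman n (a + 1) - kloosterman n a"
    using char_eig_eq[OF assms(1,2)] assms(3,4) by simp
  hence "real_of_int (4 * char_eig n a) = real_of_int (kloosterman n (a + 1) - kloosterman n a)"
    by (simp only:)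
  moreover have "a + 1 \<in> gf n" "a + 1 \<noteq> 0"
    using assms by (auto simp: add_eq_0_iff_F2bar)
  ultimately show ?thesis
    using kloosterman_weil[of n a] kloosterman_weil[of n "a + 1"] assms by auto
qed

text \<open>Positivity alone gives 2^n + 2 on the left; both sides of the count being multiples of 4
  raises it to 2^n + 4, exactly what 2^n \<le> 4 (k - 1) requires of the degree k.\<close>

lemma card_conn_set_ge:
  assumes "n \<ge> 2" "kloosterman n 1 > 0"
  shows "2 ^ n + 4 \<le> 4 * real (card (conn_set n))"
proof -
  obtain m where "n = Suc (Suc m)" using assms(1) by (metis add_2_eq_Suc le_Suc_ex)
  hence "(2::int) ^ n = 4 * 2 ^ m" by simp
  hence "2 ^ n + 4 \<le> 4 * int (card (conn_set n))"
    using card_conn_set[of n] assms by presburger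
  hence "real_of_int (2 ^ n + 4) \<le> real_of_int (4 * int (card (conn_set n)))"
    by (simp only: of_int_le_iff)
  thus ?thesis by simp
qed

lemma char_eig_ramanujan:
  assumes n: "n \<ge> 4" and K: "kloosterman n 1 > 0" and a: "a \<in> gf n"
    and ne: "\<bar>real_of_int (char_eig n a)\<bar> \<noteq> real (card (conn_set n))"
  shows "real_of_int (char_eig n a) \<le> 2 * sqrt (real (card (conn_set n)) - 1)"
proof -
  have n0: "n > 0" using n by simp
  have "a \<noteq> 0" "a \<noteq> 1" using ne char_eig_0[OF n0] char_eig_1[OF n0] by auto
  hence "real_of_int (char_eig n a) \<le> sqrt (2 ^ n)" using char_eig_le a n0 by blast
  also have "\<dots> \<le> sqrt (4 * (real (card (conn_set n)) - 1))"
    using card_conn_set_ge[of n] K n by (intro real_sqrt_le_mono) simp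
  also have "\<dots> = 2 * sqrt (real (card (conn_set n)) - 1)"
    by (simp only: real_sqrt_mult) simp
  finally show ?thesis .
qed

text \<open>Serves connectedness. From \<open>n \<ge> 4\<close> follows sqrt(2^n) \<ge> 4, hence 4
  sqrt(2^n) \<le> 2^n, which is below four times the degree; at a = 1 the eigenvalue is
  negative.\<close>

lemma char_eig_neq_degree:
  assumes n: "n \<ge> 4" and K: "kloosterman n 1 > 0" and a: "a \<in> gf n" "a \<noteq> 0"
  shows "real_of_int (char_eig n a) < real (card (conn_set n))"
proof -
  have n0: "n > 0" using n by simp
  have ge: "2 ^ n + 4 \<le> 4 * real (card (conn_set n))"
    using card_conn_set_ge[of n] K n by simp
  show ?thesis
  proof (cases "a = 1")
    case True
    have "(0::real) < 2 ^ n" by simp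
    hence "0 < real (card (conn_set n))" using ge by linarith
    thus ?thesis using True char_eig_1[OF n0] by simp
  next
    case False
    have "(2::real) ^ 4 \<le> 2 ^ n" using n by (intro power_increasing) auto
    hence "sqrt (2 ^ n) \<ge> sqrt (4\<^sup>2)" by (intro real_sqrt_le_mono) simp
    hence "4 * sqrt (2 ^ n) \<le> sqrt (2 ^ n) * sqrt (2 ^ n)" by (intro mult_right_mono) auto
    thus ?thesis using char_eig_le[OF n0 a False] ge by simp
  qed
qed

section \<open>Fourier transform on the additive group\<close>

lemma sum_chi_orthogonal:
  assumes "n > 0" "x \<in> gf n"
  shows "(\<Sum>a\<in>gf n. chi n (a * x)) = (if x = 0 then 2 ^ n else 0)"
proof -
  have "(\<Sum>a\<in>gf n. chi n (a * x)) = 1 + (\<Sum>a\<in>gf n - {0}. chi n (x * a))"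
    using assms by (subst sum.remove[of _ 0]) (auto simp: mult.commute)
  thus ?thesis using sum_chi_mult[OF assms] by simp
qed

text \<open>The characters take only the values 1 and -1, so a real transform suffices and is its
  own inverse up to the factor 2^n.\<close>

definition fourier :: "nat \<Rightarrow> (F2bar \<Rightarrow> real) \<Rightarrow> F2bar \<Rightarrow> real" where
  "fourier n w a = (\<Sum>x\<in>gf n. real_of_int (chi n (a * x)) * w x)"

lemma fourier_inversion:
  assumes n: "n > 0" and x: "x \<in> gf n"
  shows "(\<Sum>a\<in>gf n. real_of_int (chi n (a * x)) * fourier n w a) = 2 ^ n * w x"
proof -
  have "(\<Sum>a\<in>gf n. real_of_int (chi n (a * x)) * fourier n w a)
      = (\<Sum>a\<in>gf n. \<Sum>y\<in>gf n. real_of_int (chi n (a * (x + y))) * w y)"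
    unfolding fourier_def sum_distrib_left
    using x by (intro sum.cong refl) (auto simp: distrib_left chi_add gf_mult)
  also have "\<dots> = (\<Sum>y\<in>gf n. \<Sum>a\<in>gf n. real_of_int (chi n (a * (x + y))) * w y)"
    by (rule sum.swap)
  also have "\<dots> = (\<Sum>y\<in>gf n. real_of_int (\<Sum>a\<in>gf n. chi n (a * (x + y))) * w y)"
    by (simp add: sum_distrib_right)
  also have "\<dots> = (\<Sum>y\<in>gf n. if y = x then 2 ^ n * w x else 0)"
    using n x by (intro sum.cong refl) (auto simp: sum_chi_orthogonal gf_add add_eq_0_iff_F2bar)
  also have "\<dots> = 2 ^ n * w x" using n x by simp
  finally show ?thesis .
qed

text \<open>Adjacency is convolution with the indicator of \<open>conn_set n\<close>, which the
  characters diagonalise. So \<open>l\<close> is \<open>char_eig n a\<close> wherever the transform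
  of \<open>w\<close> is nonzero.\<close>

lemma fourier_eigenvector:
  assumes n: "n > 0" and a: "a \<in> gf n"
    and w: "\<And>x. x \<in> gf n \<Longrightarrow> (\<Sum>y\<in>gf n. if x + y \<in> conn_set n then w y else 0) = l * w x"
  shows "l * fourier n w a = real_of_int (char_eig n a) * fourier n w a"
proof -
  have "l * fourier n w a = (\<Sum>x\<in>gf n. real_of_int (chi n (a * x)) * (l * w x))"
    by (simp add: fourier_def sum_distrib_left mult_ac)
  also have "\<dots> = (\<Sum>x\<in>gf n. real_of_int (chi n (a * x)) *
      (\<Sum>y\<in>gf n. if x + y \<in> conn_set n then w y else 0))"
    by (intro sum.cong refl) (simp add: w)
  also have "\<dots> = (\<Sum>x\<in>gf n. \<Sum>y\<in>gf n. if x + y \<in> conn_set n then real_of_int (chi n (a * x)) * w y else 0)"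
    unfolding sum_distrib_left by (intro sum.cong refl) simp
  also have "\<dots> = (\<Sum>y\<in>gf n. \<Sum>x\<in>gf n. if x + y \<in> conn_set n then real_of_int (chi n (a * x)) * w y else 0)"
    by (rule sum.swap)
  also have "\<dots> = (\<Sum>y\<in>gf n. real_of_int (chi n (a * y)) * w y * real_of_int (char_eig n a))"
  proof (rule sum.cong[OF refl])
    fix y assume y: "y \<in> gf n"
    have "(\<Sum>x\<in>gf n. if x + y \<in> conn_set n then real_of_int (chi n (a * x)) * w y else 0)
        = (\<Sum>x\<in>gf n. if (x + y) + y \<in> conn_set n then real_of_int (chi n (a * (x + y))) * w y else 0)"
      by (rule sum.reindex_bij_betw[OF bij_betw_gf_add[OF y], symmetric])
    also have "\<dots> = (\<Sum>x\<in>gf n. if x \<in> conn_set n then real_of_int (chi n (a * x) * chi n (a * y)) * w y else 0)"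
      using a y by (intro sum.cong refl) (auto simp: add.assoc distrib_left chi_add gf_mult)
    also have "\<dots> = (\<Sum>x\<in>conn_set n. real_of_int (chi n (a * x) * chi n (a * y)) * w y)"
      using n conn_set_subset by (simp add: sum.inter_restrict[symmetric] Int_absorb1)
    also have "\<dots> = real_of_int (chi n (a * y)) * w y * real_of_int (char_eig n a)"
      by (simp add: char_eig_def sum_distrib_left mult_ac)
    finally show "(\<Sum>x\<in>gf n. if x + y \<in> conn_set n then real_of_int (chi n (a * x)) * w y else 0) = \<dots>" .
  qed
  also have "\<dots> = real_of_int (char_eig n a) * fourier n w a"
    by (simp add: fourier_def sum_distrib_left mult_ac)
  finally show ?thesis .
qed

lemma eigenvalue_is_char_eig:
  assumes n: "n > 0" and x: "x \<in> gf n" "w x \<noteq> 0"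
    and w: "\<And>x. x \<in> gf n \<Longrightarrow> (\<Sum>y\<in>gf n. if x + y \<in> conn_set n then w y else 0) = l * w x"
  obtains a where "a \<in> gf n" "l = real_of_int (char_eig n a)"
proof -
  have "\<exists>a\<in>gf n. fourier n w a \<noteq> 0"
  proof (rule ccontr)
    assume "\<not> ?thesis"
    hence "2 ^ n * w x = 0"
      using fourier_inversion[OF n x(1), of w] by simp
    thus False using x(2) by simp
  qed
  thus ?thesis using fourier_eigenvector[OF n _ w] that by auto
qed

text \<open>All nontrivial Fourier coefficients vanish, and inversion leaves only the constant
  term.\<close>

lemma eigenvector_constant:
  assumes n: "n > 0" and x: "x \<in> gf n"
    and w: "\<And>x. x \<in> gf n \<Longrightarrow> (\<Sum>y\<in>gf n. if x + y \<in> conn_set n then w y else 0) = l * w x"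
    and l: "\<And>a. a \<in> gf n \<Longrightarrow> a \<noteq> 0 \<Longrightarrow> real_of_int (char_eig n a) \<noteq> l"
  shows "w x = w 0"
proof -
  have "fourier n w a = 0" if "a \<in> gf n" "a \<noteq> 0" for a
    using fourier_eigenvector[OF n that(1) w] l[OF that] by auto
  hence "2 ^ n * w y = fourier n w 0" if "y \<in> gf n" for y
    unfolding fourier_inversion[OF n that, of w, symmetric]
    using n by (subst sum.remove[of _ 0]) auto
  hence "2 ^ n * w x = 2 ^ n * w 0" using x by simp
  thus ?thesis by simp
qed

section \<open>Embedding finite fields into the algebraic closure\<close>

text \<open>Horner evaluation at \<open>g\<close>; the coefficients 0 and 1 are carried into the
  carrier-based ring by a case distinction.\<close>

definition bit_eval :: "('a, 'b) ring_scheme \<Rightarrow> 'a \<Rightarrow> bit poly \<Rightarrow> 'a" where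
  "bit_eval R g p = foldr (\<lambda>c y. (if c = 1 then \<one>\<^bsub>R\<^esub> else \<zero>\<^bsub>R\<^esub>) \<oplus>\<^bsub>R\<^esub> g \<otimes>\<^bsub>R\<^esub> y) (Polynomial.coeffs p) \<zero>\<^bsub>R\<^esub>"

definition closure_eval :: "F2bar \<Rightarrow> bit poly \<Rightarrow> F2bar" where
  "closure_eval t p = poly (map_poly to_ac p) t"

lemma closure_eval_0 [simp]: "closure_eval t 0 = 0"
  by (simp add: closure_eval_def)

lemma closure_eval_pCons [simp]: "closure_eval t (pCons c p) = to_ac c + t * closure_eval t p"
  unfolding closure_eval_def by (subst Polynomial.map_poly_pCons) simp_all

lemma closure_eval_1 [simp]: "closure_eval t 1 = 1"
  by (simp add: one_pCons)

lemma closure_eval_add: "closure_eval t (p + q) = closure_eval t p + closure_eval t q"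
proof (induction p q rule: poly_induct2)
  case (pCons a p b q)
  show ?case by (simp only: add_pCons closure_eval_pCons to_ac_add pCons) (simp add: algebra_simps)
qed simp

lemma closure_eval_smult: "closure_eval t (Polynomial.smult c p) = to_ac c * closure_eval t p"
  by (induction p) (simp_all add: algebra_simps)

lemma closure_eval_mult: "closure_eval t (p * q) = closure_eval t p * closure_eval t q"
  by (induction p) (simp_all add: closure_eval_add closure_eval_smult algebra_simps)

context field
begin

text \<open>In any ring, 2^k times one is (1 + 1)^k. The order of the additive group annihilates
  one, so 1 + 1 is nilpotent, hence zero in a field.\<close>

lemma char_two_add:
  assumes "Coset.order R = 2 ^ m"
  shows "\<one> \<oplus> \<one> = \<zero>"
proof -
  have dbl: "add_pow R ((2::nat) ^ k) \<one> = (\<one> \<oplus> \<one>) [^] k" for k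
  proof (induction k)
    case (Suc k)
    have "add_pow R ((2::nat) ^ Suc k) \<one> = add_pow R ((2::nat) ^ k) \<one> \<oplus> add_pow R ((2::nat) ^ k) \<one>"
      by (simp add: mult_2 add.nat_pow_mult)
    also have "\<dots> = (\<one> \<oplus> \<one>) [^] k \<otimes> (\<one> \<oplus> \<one>)"
      unfolding Suc by (simp add: r_distr)
    finally show ?case by simp
  qed simp
  have "add_pow R (Coset.order R) \<one> = \<zero>"
    using add.pow_order_eq_1[of \<one>] by (simp add: Coset.order_def)
  hence "(\<one> \<oplus> \<one>) [^] m = \<zero>" using dbl[of m] assms by simp
  moreover have "x [^] m \<noteq> \<zero>" if "x \<in> carrier R" "x \<noteq> \<zero>" for x
    using that by (induction m) (simp_all add: integral_iff)
  ultimately show ?thesis by (metis add.m_closed one_closed)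
qed

context
  fixes g assumes g: "g \<in> carrier R" and two: "\<one> \<oplus> \<one> = \<zero>"
begin

lemma bit_eval_0: "bit_eval R g 0 = \<zero>"
  by (simp add: bit_eval_def)

lemma bit_eval_pCons: "bit_eval R g (pCons c p) = (if c = 1 then \<one> else \<zero>) \<oplus> g \<otimes> bit_eval R g p"
proof (cases "c = 0 \<and> p = 0")
  case True
  thus ?thesis using g by (simp add: bit_eval_0)
next
  case False
  thus ?thesis by (cases "p = 0") (simp_all add: bit_eval_def)
qed

lemma bit_eval_closed: "bit_eval R g p \<in> carrier R"
  by (induction p) (use g in \<open>simp_all add: bit_eval_0 bit_eval_pCons\<close>)

lemma add_self: "x \<in> carrier R \<Longrightarrow> x \<oplus> x = \<zero>"
  using two r_distr[of \<one> \<one> x] l_distr[of \<one> \<one> x] by simp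

lemma bit_eval_add: "bit_eval R g (p + q) = bit_eval R g p \<oplus> bit_eval R g q"
proof (induction p q rule: poly_induct2)
  case (pCons a p b q)
  have *: "(if a + b = 1 then \<one> else \<zero>) = (if a = 1 then \<one> else \<zero>) \<oplus> (if b = 1 then \<one> else \<zero>)"
    using two by (cases a; cases b) auto
  show ?case
    using g bit_eval_closed by (simp only: add_pCons bit_eval_pCons pCons.IH *) (simp add: r_distr a_ac)
qed (simp add: bit_eval_0)

lemma bit_eval_smult: "bit_eval R g (Polynomial.smult c p) = (if c = 1 then bit_eval R g p else \<zero>)"
  by (cases c) (simp_all add: bit_eval_0)

lemma bit_eval_mult: "bit_eval R g (p * q) = bit_eval R g p \<otimes> bit_eval R g q"
proof (induction p)
  case (pCons a p)
  show ?case
    using g bit_eval_closed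
    by (simp add: bit_eval_add bit_eval_smult bit_eval_pCons pCons.IH l_distr m_assoc)
qed (simp add: bit_eval_0 bit_eval_closed)

lemma bit_eval_1: "bit_eval R g 1 = \<one>"
  using g by (simp add: one_pCons bit_eval_pCons bit_eval_0)

lemma bit_eval_monom: "bit_eval R g (Polynomial.monom 1 i) = g [^] i"
proof (induction i)
  case 0
  show ?case by (simp add: bit_eval_1 flip: one_pCons)
next
  case (Suc i)
  have "bit_eval R g (Polynomial.monom 1 (Suc i)) = g \<otimes> g [^] i"
    using g by (simp add: monom_Suc bit_eval_pCons Suc)
  thus ?case using g by (simp add: m_comm)
qed

end

text \<open>
  A generator of the multiplicative group satisfies a polynomial equation over the prime field;
  sending it to a root of a polynomial of least degree gives the embedding.
\<close>
lemma ex_embedding: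
  assumes ord: "Coset.order R = 2 ^ m"
  obtains f :: "'a \<Rightarrow> F2bar" where
    "\<And>x y. x \<in> carrier R \<Longrightarrow> y \<in> carrier R \<Longrightarrow> f (x \<oplus> y) = f x + f y"
    "\<And>x y. x \<in> carrier R \<Longrightarrow> y \<in> carrier R \<Longrightarrow> f (x \<otimes> y) = f x * f y"
    "f \<one> = 1"
proof -
  have fin: "finite (carrier R)"
    using ord by (intro card_ge_0_finite) (simp add: Coset.order_def)
  obtain g where g0: "g \<in> carrier (Multiplicative_Group.mult_of R)"
      and gen: "carrier (Multiplicative_Group.mult_of R) = {g [^] i | i::nat. i \<in> UNIV}"
    using finite_field_mult_group_has_gen[OF fin] by blast
  hence g: "g \<in> carrier R" by simp
  note two = char_two_add[OF ord]
  let ?e = "bit_eval R g"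
  note closed = bit_eval_closed[OF g two]
  note e_add = bit_eval_add[OF g two] and e_mult = bit_eval_mult[OF g two]
    and e_1 = bit_eval_1[OF g two] and e_0 = bit_eval_0[OF g two]
    and e_monom = bit_eval_monom[OF g two]
  have surj: "\<exists>p. ?e p = x" if "x \<in> carrier R" for x
  proof (cases "x = \<zero>")
    case False
    hence "x \<in> carrier (Multiplicative_Group.mult_of R)" using that by simp
    then obtain i where "x = g [^] (i::nat)" unfolding gen by blast
    thus ?thesis using e_monom by metis
  qed (use e_0 in auto)
  have "\<exists>p. p \<noteq> 0 \<and> ?e p = \<zero>"
  proof -
    have "range (\<lambda>i::nat. g [^] i) \<subseteq> carrier R" using g by auto
    hence "\<not> inj (\<lambda>i::nat. g [^] i)"
      using fin finite_subset infinite_UNIV_nat by (metis finite_imageD)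
    then obtain i j :: nat where ij: "g [^] i = g [^] j" "i \<noteq> j" by (auto simp: inj_def)
    have "Polynomial.coeff (Polynomial.monom 1 i + Polynomial.monom 1 j :: bit poly) i = 1"
      using ij by simp
    hence "Polynomial.monom 1 i + Polynomial.monom 1 j \<noteq> (0 :: bit poly)"
      by (metis Polynomial.coeff_0 zero_neq_one)
    moreover have "?e (Polynomial.monom 1 i + Polynomial.monom 1 j) = \<zero>"
      using ij g by (simp add: e_add e_monom add_self[OF g two])
    ultimately show ?thesis by blast
  qed
  then obtain p0 where p0: "p0 \<noteq> 0 \<and> ?e p0 = \<zero>" by blast
  obtain p where "(p \<noteq> 0 \<and> ?e p = \<zero>) \<and>
      (\<forall>q. q \<noteq> 0 \<and> ?e q = \<zero> \<longrightarrow> Polynomial.degree p \<le> Polynomial.degree q)"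
    using ex_has_least_nat[of "\<lambda>p. p \<noteq> 0 \<and> ?e p = \<zero>", OF p0, of Polynomial.degree] ..
  hence p: "p \<noteq> 0" "?e p = \<zero>"
      and least: "\<And>q. q \<noteq> 0 \<Longrightarrow> ?e q = \<zero> \<Longrightarrow> Polynomial.degree p \<le> Polynomial.degree q"
    by simp_all
  have dvd: "p dvd q" if "?e q = \<zero>" for q
  proof (rule ccontr)
    assume "\<not> p dvd q"
    hence r: "q mod p \<noteq> 0" by (simp add: dvd_eq_mod_eq_0)
    have "?e q = ?e (q div p) \<otimes> ?e p \<oplus> ?e (q mod p)"
      by (metis e_add e_mult div_mult_mod_eq)
    hence "?e (q mod p) = \<zero>" using that p(2) closed by simp
    hence "Polynomial.degree p \<le> Polynomial.degree (q mod p)" using least r by blast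
    thus False using degree_mod_less[OF p(1), of q] r by simp
  qed
  have "Polynomial.degree p \<noteq> 0"
  proof
    assume "Polynomial.degree p = 0"
    then obtain c where "p = [:c:]" by (rule degree_eq_zeroE)
    hence "p = 1" using p(1) by (simp add: one_pCons)
    thus False using p(2) e_1 by simp
  qed
  hence "Polynomial.degree (map_poly (to_ac :: bit \<Rightarrow> F2bar) p) > 0"
    by (subst degree_map_poly) auto
  then obtain t where t: "closure_eval t p = 0"
    unfolding closure_eval_def using alg_closed_imp_poly_has_root by blast
  \<comment> \<open>An arbitrary preimage is chosen: two preimages differ by a multiple of
    \<open>p\<close>, which vanishes at \<open>t\<close>.\<close>
  define f where "f = (\<lambda>x. closure_eval t (SOME q. ?e q = x))"
  have f: "f (?e q) = closure_eval t q" for q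
  proof -
    define s where "s = (SOME s. ?e s = ?e q)"
    have "?e s = ?e q" unfolding s_def by (rule someI) (rule refl)
    hence "?e (s + q) = \<zero>" by (simp add: e_add add_self[OF g two] closed)
    then obtain u where "s + q = p * u" using dvd by blast
    hence "closure_eval t s + closure_eval t q = 0"
      by (metis closure_eval_add closure_eval_mult t mult_zero_left)
    thus ?thesis by (simp add: f_def s_def add_eq_0_iff_F2bar)
  qed
  show ?thesis
  proof (rule that)
    show "f \<one> = 1" using f[of 1] by (simp add: e_1)
    fix x y assume "x \<in> carrier R" "y \<in> carrier R"
    then obtain a b where "x = ?e a" "y = ?e b" using surj by metis
    thus "f (x \<oplus> y) = f x + f y" "f (x \<otimes> y) = f x * f y"
      by (simp_all add: f closure_eval_add closure_eval_mult flip: e_add e_mult)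
  qed
qed

text \<open>A homomorphism of fields is injective, x^(2^m - 1) = 1 places its image in
  \<open>gf m\<close>, and equal cardinalities make it onto. The trace is built from sums and
  powers, hence transported.\<close>

lemma ex_iso_gf:
  assumes ord: "Coset.order R = 2 ^ m" and m: "m > 0"
  obtains f :: "'a \<Rightarrow> F2bar" where
    "bij_betw f (carrier R) (gf m)"
    "\<And>x y. x \<in> carrier R \<Longrightarrow> y \<in> carrier R \<Longrightarrow> f (x \<oplus> y) = f x + f y"
    "\<And>x. x \<in> carrier R \<Longrightarrow> f x = 0 \<longleftrightarrow> x = \<zero>"
    "\<And>x. x \<in> carrier R - {\<zero>} \<Longrightarrow> f (inv x) = inverse (f x)"
    "\<And>x. x \<in> carrier R \<Longrightarrow> f (field_trace R m x) = tr m (f x)"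
    "f \<one> = 1"
proof -
  have fin: "finite (carrier R)"
    using ord by (intro card_ge_0_finite) (simp add: Coset.order_def)
  obtain f :: "'a \<Rightarrow> F2bar" where
    add: "\<And>x y. x \<in> carrier R \<Longrightarrow> y \<in> carrier R \<Longrightarrow> f (x \<oplus> y) = f x + f y" and
    mult: "\<And>x y. x \<in> carrier R \<Longrightarrow> y \<in> carrier R \<Longrightarrow> f (x \<otimes> y) = f x * f y" and
    one: "f \<one> = 1"
    using ex_embedding[OF ord] by blast
  have zero: "f \<zero> = 0" using add[of \<zero> \<zero>] by simp
  have inv_mult: "f (inv x) * f x = 1" if "x \<in> carrier R - {\<zero>}" for x
    using that by (metis DiffD1 field_Units Units_inv_closed Units_l_inv mult one)
  have eq_0: "f x = 0 \<longleftrightarrow> x = \<zero>" if "x \<in> carrier R" for x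
    using inv_mult[of x] zero that by fastforce
  have inv: "f (inv x) = inverse (f x)" if "x \<in> carrier R - {\<zero>}" for x
    using inv_mult[OF that] by (metis inverse_unique mult.commute)
  have pow: "f (x [^] k) = f x ^ k" if "x \<in> carrier R" for x and k :: nat
    using that by (induction k) (simp_all add: one mult mult.commute)
  have sum: "f (\<Oplus>i\<in>A. h i) = (\<Sum>i\<in>A. f (h i))" if "finite A" "h \<in> A \<rightarrow> carrier R" for A :: "nat set" and h
    using that by (induction A) (simp_all add: zero add Pi_def)
  have trace: "f (field_trace R m x) = tr m (f x)" if "x \<in> carrier R" for x
    using that by (simp add: field_trace_def tr_def sum pow)
  have inj: "inj_on f (carrier R)"
  proof (rule inj_onI)
    fix x y assume xy: "x \<in> carrier R" "y \<in> carrier R" "f x = f y"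
    have "f (x \<oplus> y) = 0" "f (y \<oplus> y) = 0" using xy by (simp_all add: add)
    hence "x \<oplus> y = y \<oplus> y" using xy eq_0 by simp
    thus "x = y" using xy by simp
  qed
  have sub: "f ` carrier R \<subseteq> gf m"
  proof
    fix z assume "z \<in> f ` carrier R"
    then obtain x where x: "x \<in> carrier R" "z = f x" by blast
    show "z \<in> gf m"
    proof (cases "x = \<zero>")
      case False
      have "x [^]\<^bsub>Multiplicative_Group.mult_of R\<^esub> Coset.order (Multiplicative_Group.mult_of R) = \<one>\<^bsub>Multiplicative_Group.mult_of R\<^esub>"
        using x False by (intro group.pow_order_eq_1[OF field_mult_group]) simp
      hence "x [^] (2 ^ m - 1 :: nat) = \<one>"
        using fin ord by (simp add: order_mult_of Multiplicative_Group.nat_pow_mult_of)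
      hence "z ^ (2 ^ m - 1) = 1" using pow[OF x(1)] x one by metis
      hence "z ^ 2 ^ m = z" using power_minus_mult[of "2 ^ m" z] by simp
      thus ?thesis by (simp add: gf_def)
    qed (use x zero in simp)
  qed
  have "f ` carrier R = gf m"
    using card_image[OF inj] ord m sub by (intro card_subset_eq) (simp_all add: card_gf Coset.order_def)
  hence "bij_betw f (carrier R) (gf m)" using inj by (simp add: bij_betw_def)
  thus ?thesis by (rule that[OF _ add eq_0 inv trace one])
qed

end

section \<open>The Ramanujan property\<close>

lemma sum_conn_set_const:
  assumes "n > 0" "x \<in> gf n"
  shows "(\<Sum>y\<in>gf n. if x + y \<in> conn_set n then c else 0) = real (card (conn_set n)) * c"
proof -
  have "(\<Sum>y\<in>gf n. if x + y \<in> conn_set n then c else 0) = (\<Sum>y\<in>gf n. if y + x \<in> conn_set n then c else 0)"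
    by (simp add: add.commute)
  also have "\<dots> = (\<Sum>y\<in>gf n. if y \<in> conn_set n then c else 0)"
    by (rule sum.reindex_bij_betw[OF bij_betw_gf_add[OF assms(2)]])
  also have "\<dots> = (\<Sum>y\<in>conn_set n. c)"
    using assms conn_set_subset by (simp add: sum.inter_restrict[symmetric] Int_absorb1)
  finally show ?thesis by simp
qed

text \<open>Separates the graph theory from the ring: a labelling of the vertices by
  \<open>gf n\<close> suffices, and in characteristic two \<open>f u + f v\<close> is the
  difference.\<close>

locale gf_graph =
  fixes f :: "'a \<Rightarrow> F2bar" and V :: "'a set" and n :: nat and G :: "'a pair_pre_digraph"
  assumes bij: "bij_betw f V (gf n)" and n4: "n \<ge> 4" and K_pos: "kloosterman n 1 > 0"
    and pverts: "pverts G = V"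
    and parcs: "\<And>u v. (u, v) \<in> parcs G \<longleftrightarrow> u \<in> V \<and> v \<in> V \<and> f u + f v \<in> conn_set n"
begin

lemma n_pos: "n > 0"
  using n4 by simp

lemma f_gf: "u \<in> V \<Longrightarrow> f u \<in> gf n"
  using bij by (auto simp: bij_betw_def)

lemma finite_V: "finite V"
  using bij_betw_finite[OF bij] n_pos by simp

lemma is_pair_graph: "pair_graph G"
proof
  show "fst e \<in> pverts G" "snd e \<in> pverts G" if "e \<in> parcs G" for e
    using that parcs[of "fst e" "snd e"] by (simp_all add: pverts)
  show "finite (pverts G)" using finite_V by (simp add: pverts)
  have "parcs G \<subseteq> V \<times> V" using parcs by auto
  thus "finite (parcs G)" using finite_V finite_subset by blast
  \<comment> \<open>A loop would have the label \<open>f u + f u = 0\<close>, which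
    \<open>conn_set n\<close> excludes.\<close>
  show "fst e \<noteq> snd e" if "e \<in> parcs G" for e
    using that parcs[of "fst e" "snd e"] by (auto simp: conn_set_def)
  show "symmetric G"
    unfolding Digraph.symmetric_def by (auto simp: sym_def parcs add.commute)
qed

lemma is_regular: "regular_graph G (card (conn_set n))"
  unfolding regular_graph_def
proof
  fix v assume "v \<in> pverts G"
  hence v: "v \<in> V" by (simp add: pverts)
  have "bij_betw (\<lambda>e. f v + f (snd e)) (out_arcs (with_proj G) v) (conn_set n)"
  proof (rule bij_betw_imageI)
    show "inj_on (\<lambda>e. f v + f (snd e)) (out_arcs (with_proj G) v)"
      using bij by (auto intro!: inj_onI simp: parcs bij_betw_def inj_on_eq_iff)
    show "(\<lambda>e. f v + f (snd e)) ` out_arcs (with_proj G) v = conn_set n"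
    proof (intro equalityI subsetI)
      fix z assume z: "z \<in> conn_set n"
      hence "f v + z \<in> gf n" using v f_gf conn_set_subset by blast
      then obtain u where u: "u \<in> V" "f u = f v + z" using bij by (force simp: bij_betw_def)
      hence "(v, u) \<in> out_arcs (with_proj G) v" "z = f v + f (snd (v, u))"
        using v z by (simp_all add: parcs)
      thus "z \<in> (\<lambda>e. f v + f (snd e)) ` out_arcs (with_proj G) v" by blast
    qed (auto simp: parcs)
  qed
  thus "out_degree (with_proj G) v = card (conn_set n)"
    unfolding out_degree_def by (rule bij_betw_same_card)
qed

text \<open>
  The indicator of a connected component is an eigenvector for the degree, hence constant.
\<close>
lemma is_connected: "Digraph_Component.connected (with_proj G)"
  unfolding connected_conv
proof (intro conjI ballI)
  have "V \<noteq> {}" using bij gf_0 by (auto simp: bij_betw_def)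
  thus "verts (with_proj G) \<noteq> {}" by (simp add: pverts)
  let ?r = "rtrancl_on V ((parcs G)\<^sup>s)"
  fix u v assume "u \<in> verts (with_proj G)" "v \<in> verts (with_proj G)"
  hence uv: "u \<in> V" "v \<in> V" by (simp_all add: pverts)
  define g where "g = inv_into V f"
  have g: "g x \<in> V" "f (g x) = x" if "x \<in> gf n" for x
    using that bij by (auto simp: g_def bij_betw_def inv_into_into f_inv_into_f)
  have gf: "g (f x) = x" if "x \<in> V" for x
    using that bij by (simp add: g_def bij_betw_def)
  define w :: "F2bar \<Rightarrow> real" where "w = (\<lambda>x. if (u, g x) \<in> ?r then 1 else 0)"
  have step: "(u, g y) \<in> ?r" if "(u, g x) \<in> ?r" "x + y \<in> conn_set n" "x \<in> gf n" "y \<in> gf n" for x y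
  proof (rule rtrancl_on_into_rtrancl_on[OF that(1)])
    show "(g x, g y) \<in> (parcs G)\<^sup>s" using that by (simp add: symcl_def parcs g)
    show "g y \<in> V" using that by (simp add: g)
  qed
  \<comment> \<open>Neighbours are reachable from \<open>u\<close> together or not at all, so
    \<open>w y\<close> may be replaced by \<open>w x\<close>.\<close>
  have eig: "(\<Sum>y\<in>gf n. if x + y \<in> conn_set n then w y else 0) = real (card (conn_set n)) * w x"
    if x: "x \<in> gf n" for x
  proof -
    have "(if x + y \<in> conn_set n then w y else 0) = (if x + y \<in> conn_set n then w x else 0)"
      if "y \<in> gf n" for y
      using step[of x y] step[of y x] x that by (auto simp: w_def add.commute)
    hence "(\<Sum>y\<in>gf n. if x + y \<in> conn_set n then w y else 0)
        = (\<Sum>y\<in>gf n. if x + y \<in> conn_set n then w x else 0)"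
      by (rule sum.cong[OF refl])
    thus ?thesis using sum_conn_set_const[OF n_pos x] by simp
  qed
  have "w x = w 0" if "x \<in> gf n" for x
    by (rule eigenvector_constant[OF n_pos that eig])
      (use char_eig_neq_degree[OF n4 K_pos] in force)+
  hence "w (f v) = w (f u)" using f_gf uv by metis
  moreover have "(u, u) \<in> ?r" using uv by simp
  ultimately have "(u, v) \<in> ?r" using uv by (simp add: w_def gf split: if_splits)
  thus "(u, v) \<in> rtrancl_on (verts (with_proj G)) ((arcs_ends (with_proj G))\<^sup>s)"
    by (simp add: pverts)
qed

text \<open>Composing the enumeration with \<open>f\<close> identifies matrix indices with
  \<open>gf n\<close>, so an eigenvector becomes a function open to the Fourier argument.\<close>

lemma graph_eigenvalue_cases:
  assumes "graph_eigenvalue G l"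
  obtains a where "a \<in> gf n" "l = real_of_int (char_eig n a)"
proof -
  obtain vs where vs: "distinct vs" "set vs = V" "eigenvalue (adjacency_matrix G vs) l"
    using assms by (auto simp: graph_eigenvalue_def pverts)
  let ?N = "length vs" and ?A = "adjacency_matrix G vs"
  obtain v where v: "v \<in> carrier_vec ?N" "v \<noteq> 0\<^sub>v ?N" "?A *\<^sub>v v = l \<cdot>\<^sub>v v"
    using vs(3) by (auto simp: eigenvalue_def eigenvector_def adjacency_matrix_def)
  define h where "h = (\<lambda>i. f (vs ! i))"
  have "bij_betw ((!) vs) {..<?N} V" using vs by (intro bij_betw_nth) auto
  hence h: "bij_betw h {..<?N} (gf n)"
    using bij_betw_trans[OF _ bij] by (simp add: h_def o_def)
  define g where "g = inv_into {..<?N} h"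
  have gh: "g (h i) = i" if "i < ?N" for i
    using that h by (simp add: g_def bij_betw_def)
  define w where "w = (\<lambda>x. v $ g x)"
  have eig: "(\<Sum>y\<in>gf n. if x + y \<in> conn_set n then w y else 0) = l * w x" if x: "x \<in> gf n" for x
  proof -
    obtain i where i: "i < ?N" "x = h i" using x h by (auto simp: bij_betw_def)
    have "(\<Sum>y\<in>gf n. if x + y \<in> conn_set n then w y else 0)
        = (\<Sum>j<?N. if x + h j \<in> conn_set n then w (h j) else 0)"
      by (rule sum.reindex_bij_betw[OF h, symmetric])
    also have "\<dots> = (\<Sum>j<?N. ?A $$ (i, j) * v $ j)"
      using i vs(2) by (intro sum.cong refl) (auto simp: adjacency_matrix_def parcs h_def w_def gh[unfolded h_def])
    also have "\<dots> = (?A *\<^sub>v v) $ i"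
      using i v(1) by (simp add: adjacency_matrix_def scalar_prod_def lessThan_atLeast0)
    also have "\<dots> = l * w x" using i v by (simp add: w_def gh)
    finally show ?thesis .
  qed
  have "\<exists>i<?N. v $ i \<noteq> 0"
    using v(1,2) by (metis carrier_vecD eq_vecI index_zero_vec)
  then obtain i where i: "i < ?N" "w (h i) \<noteq> 0" by (auto simp: w_def gh)
  moreover have "h i \<in> gf n" using i h by (auto simp: bij_betw_def)
  ultimately show ?thesis using eigenvalue_is_char_eig[OF n_pos _ _ eig] that by blast
qed

lemma is_ramanujan: "ramanujan_graph G"
  unfolding ramanujan_graph_def
proof (intro conjI exI[of _ "card (conn_set n)"] allI impI)
  fix l assume l: "graph_eigenvalue G l \<and> \<bar>l\<bar> \<noteq> real (card (conn_set n))"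
  then obtain a where "a \<in> gf n" "l = real_of_int (char_eig n a)"
    using graph_eigenvalue_cases by blast
  thus "l \<le> 2 * sqrt (real (card (conn_set n)) - 1)"
    using char_eig_ramanujan[OF n4 K_pos] l by blast
qed (rule is_pair_graph is_connected is_regular)+

end

lemma (in field) cayley_graph_ramanujan:
  assumes ord: "Coset.order R = 2 ^ m" and m: "m \<ge> 4" and K: "kloosterman m 1 > 0"
  shows "ramanujan_graph (cayley_graph (add_monoid R) (trace_set R m))"
proof -
  have m0: "m > 0" using m by simp
  obtain f :: "'a \<Rightarrow> F2bar" where bij: "bij_betw f (carrier R) (gf m)"
    and add: "\<And>x y. x \<in> carrier R \<Longrightarrow> y \<in> carrier R \<Longrightarrow> f (x \<oplus> y) = f x + f y"
    and eq_0: "\<And>x. x \<in> carrier R \<Longrightarrow> f x = 0 \<longleftrightarrow> x = \<zero>"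
    and inv: "\<And>x. x \<in> carrier R - {\<zero>} \<Longrightarrow> f (inv x) = inverse (f x)"
    and trace: "\<And>x. x \<in> carrier R \<Longrightarrow> f (field_trace R m x) = tr m (f x)"
    and one: "f \<one> = 1"
    using ex_iso_gf[OF ord m0] by blast
  have inj: "f x = f y \<longleftrightarrow> x = y" if "x \<in> carrier R" "y \<in> carrier R" for x y
    using that bij by (auto simp: bij_betw_def inj_on_eq_iff)
  have minus: "f (\<ominus> x) = f x" if "x \<in> carrier R" for x
  proof -
    have "f (\<ominus> x) + f x = 0" using that add[of "\<ominus> x" x] eq_0[of \<zero>] by (simp add: l_neg)
    thus ?thesis by (simp add: add_eq_0_iff_F2bar)
  qed
  have trace_1: "field_trace R m x = \<one> \<longleftrightarrow> tr m (f x) = 1" if "x \<in> carrier R" for x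
  proof -
    have "field_trace R m x \<in> carrier R"
      unfolding field_trace_def using that by (intro finsum_closed) auto
    thus ?thesis using inj[of "field_trace R m x" \<one>] that by (simp add: trace one)
  qed
  have mem: "z \<in> trace_set R m \<longleftrightarrow> f z \<in> conn_set m" if z: "z \<in> carrier R" for z
  \<comment> \<open>\<open>f\<close> is known to respect \<open>inv\<close> only away from zero, and
    both sets exclude zero.\<close>
  proof (cases "z = \<zero>")
    case True
    thus ?thesis using eq_0[of z] by (simp add: trace_set_def conn_set_def)
  next
    case False
    hence "inv z \<in> carrier R" using z by (simp add: field_Units)
    moreover have "f z \<in> gf m" using z bij by (auto simp: bij_betw_def)
    ultimately show ?thesis
      using z False by (simp add: trace_set_def conn_set_def trace_1 inv eq_0)
  qed
  interpret gf_graph f "carrier R" m "cayley_graph (add_monoid R) (trace_set R m)"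
  proof
    fix u v
    show "(u, v) \<in> parcs (cayley_graph (add_monoid R) (trace_set R m)) \<longleftrightarrow>
        u \<in> carrier R \<and> v \<in> carrier R \<and> f u + f v \<in> conn_set m"
    proof (cases "u \<in> carrier R \<and> v \<in> carrier R")
      case True
      have "(u, v) \<in> parcs (cayley_graph (add_monoid R) (trace_set R m)) \<longleftrightarrow> u \<oplus> \<ominus> v \<in> trace_set R m"
        using True by (simp add: cayley_graph_def a_inv_def)
      also have "\<dots> \<longleftrightarrow> f u + f v \<in> conn_set m"
        using True by (simp add: mem add minus)
      finally show ?thesis using True by simp
    qed (auto simp: cayley_graph_def)
  qed (use bij m K in \<open>simp_all add: cayley_graph_def\<close>)
  show ?thesis by (rule is_ramanujan)
qed

theorem mainTheorem5:
  fixes F :: "nat \<Rightarrow> ('a, 'b) ring_scheme"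
  assumes "\<And>m. m > 0 \<Longrightarrow> field (F m) \<and> Coset.order (F m) = 2 ^ m"
  shows "infinite {m. m > 0 \<and>
           ramanujan_graph (cayley_graph (add_monoid (F m)) (trace_set (F m) m))}"
proof -
  have "infinite ({m. m > 0 \<and> kloosterman m 1 > 0} - {..<4})"
    using infinite_kloosterman_pos by simp
  moreover have "{m. m > 0 \<and> kloosterman m 1 > 0} - {..<4} \<subseteq>
      {m. m > 0 \<and> ramanujan_graph (cayley_graph (add_monoid (F m)) (trace_set (F m) m))}"
  proof
    fix m assume "m \<in> {m. m > 0 \<and> kloosterman m 1 > 0} - {..<4}"
    hence m: "m > 0" "m \<ge> 4" "kloosterman m 1 > 0" by auto
    thus "m \<in> {m. m > 0 \<and> ramanujan_graph (cayley_graph (add_monoid (F m)) (trace_set (F m) m))}"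
      using field.cayley_graph_ramanujan[of "F m" m] assms[OF m(1)] by simp
  qed
  ultimately show ?thesis using infinite_super by blast
qed

end
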